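(* Let $E$ be a compact subset of $\mathbf{R}$, and let $D$, $\{\delta_U\}_{U\in D}$, $(\Omega, P)$, $f_\omega$ and $\psi$ be as defined in the context. Let $s \in [0,1]$ and let $\lambda$ be a Borel probability measure on $E$. Suppose that there are constants $a \in \mathbf{R}$ and $b > 0$ and some $x_0 > 0$ such that $$\psi(J, x) \geq a + b\left(\log\lambda(J) + s\log x\right)$$ for every interval $J$ and every $x \geq x_0$. Then for $P$-almost every $\omega \in \Omega$, $$\dim_{\mathrm{F}} f_\omega\lambda \geq s.$$
   Context: The Fourier transform of a Borel probability measure $\mu$ on $\mathbf{R}$ is $\widehat\mu(\xi) = \int e^{-2\pi i \xi x}\,\mathrm{d}\mu(x)$. The Fourier dimension of $\mu$ is $\dim_{\mathrm{F}} \mu = \sup\{ s \in [0,1] : |\widehat\mu(\xi)|\,|\xi|^{s/2} \text{ is bounded in } \xi\}$. Given the compact set $E \subset \mathbf{R}$, let $D$ be the (countable) set of bounded connected components of $E^c = \mathbf{R}\setminus E$. Let $\{\delta_U\}_{U \in D}$ be arbitrary non-negative numbers whose sum is finite, and let $\Omega = \prod_{U \in D}[0, \delta_U]$. For $\omega = (\omega_U)_{U\in D} \in \Omega$ define $f_\omega : E \to \mathbf{R}$ by $$f_\omega(x) = x + \sum_{U \in D,\ U \subset (-\infty, x)} \omega_U.$$ Fix a Borel probability measure $\nu$ on $[0,1]$ such that $\lim_{|\xi|\to\infty}\widehat\nu(\xi) = 0$, let $\nu_U$ be the image of $\nu$ under the map $x \mapsto \delta_U x$, and let $P$ be the product measure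 $\prod_{U\in D}\nu_U$ on $\Omega$. The measure $f_\omega\lambda$ is the push-forward of $\lambda$ by $f_\omega$: $(f_\omega\lambda)(A) = \lambda(f_\omega^{-1}(A))$. For an interval $J$ and $x > 0$, $$\psi(J,x) = \#\{U \in D : U \subset J \text{ and } \delta_U \geq x^{-1}\}.$$ For an interval $J$, $\lambda(J)$ means $\lambda(J\cap E)$, and $\log 0 = -\infty$ (so the inequality in the hypothesis is automatically satisfied when $\lambda(J) = 0$). *)

theory Defs
  imports "HOL-Probability.Probability"
begin

text \<open>
  A Borel probability measure on a set \<open>S\<close> of reals is a measure \<open>M\<close> with \<open>prob_space M\<close> and
  \<open>sets M = sets (restrict_space borel S)\<close>; in particular \<open>space M = S\<close>.
  The integral below is therefore over \<open>S\<close>, which is the integral over the whole line of the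
  extension of \<open>M\<close> by zero.
\<close>

definition fourier_transform :: "real measure \<Rightarrow> real \<Rightarrow> complex" where
  "fourier_transform \<mu> \<xi> =
     (\<integral>x. exp (- (2 * of_real pi * \<i> * of_real \<xi> * of_real x)) \<partial>\<mu>)"

text \<open>
  For a probability measure, the set below contains \<open>0\<close> and is bounded above by \<open>1\<close>, so the
  supremum is genuine. The convention \<open>0 powr 0 = 0\<close> only affects the value at \<open>\<xi> = 0\<close> and is
  irrelevant for boundedness.
\<close>

definition fourier_dim :: "real measure \<Rightarrow> real" where
  "fourier_dim \<mu> =
     Sup {s \<in> {0..1}. bounded (range (\<lambda>\<xi>. cmod (fourier_transform \<mu> \<xi>) * \<bar>\<xi>\<bar> powr (s / 2)))}"

definition bounded_gaps :: "real set \<Rightarrow> real set set" where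
  "bounded_gaps E = {U \<in> components (- E). bounded U}"

definition perturb :: "real set \<Rightarrow> (real set \<Rightarrow> real) \<Rightarrow> real \<Rightarrow> real" where
  "perturb E \<omega> x = x + (\<Sum>\<^sub>\<infinity>U\<in>{U \<in> bounded_gaps E. U \<subseteq> {..<x}}. \<omega> U)"

text \<open>
  The image of \<open>\<nu>\<close> under \<open>x \<mapsto> \<delta> U * x\<close> is taken as a Borel measure on \<open>[0, \<delta> U]\<close>, so that
  the space of the product measure is exactly \<open>\<Omega>\<close>, the product of these intervals.
\<close>

definition perturbation_measure ::
  "real set \<Rightarrow> (real set \<Rightarrow> real) \<Rightarrow> real measure \<Rightarrow> (real set \<Rightarrow> real) measure" where
  "perturbation_measure E \<delta> \<nu> =
     (\<Pi>\<^sub>M U\<in>bounded_gaps E. distr \<nu> (restrict_space borel {0..\<delta> U}) (\<lambda>x. \<delta> U * x))"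

lemma space_perturbation_measure:
  "space (perturbation_measure E \<delta> \<nu>) = (\<Pi>\<^sub>E U\<in>bounded_gaps E. {0..\<delta> U})"
  by (simp add: perturbation_measure_def space_PiM space_restrict_space)

text \<open>
  If \<open>\<delta>\<close> is non-negative with finite sum over the gaps and \<open>x > 0\<close>, the set counted here is
  finite.
\<close>

definition gap_count :: "real set \<Rightarrow> (real set \<Rightarrow> real) \<Rightarrow> real set \<Rightarrow> real \<Rightarrow> nat" where
  "gap_count E \<delta> J x = card {U \<in> bounded_gaps E. U \<subseteq> J \<and> inverse x \<le> \<delta> U}"

end

theory Submission
  imports Defs
begin

text \<open>
  Fix \<open>q\<close> and expand the moment of order \<open>2 q\<close> of the transform at \<open>\<xi>\<close> as an integral over \<open>2 q\<close>
  points \<open>x\<close> of \<open>E\<close>. Averaging over \<open>\<omega>\<close> first gives a product over the gaps \<open>U\<close> of factors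
  \<open>fourier_transform \<nu> (\<xi> * \<delta> U * k)\<close>, where the integer \<open>k\<close> is odd whenever \<open>U\<close> lies to the left of
  an odd number of the points. Since the transform of \<open>\<nu>\<close> vanishes at infinity, each such gap with
  \<open>\<delta> U \<ge> C / \<bar>\<xi>\<bar>\<close> contributes a factor at most \<open>\<epsilon>\<close>. Pairing neighbouring points and using the lower
  bound on the number of gaps, each of the \<open>q\<close> pairs contributes \<open>O(\<bar>\<xi>\<bar> powr (- s))\<close> to the
  integral, so that the moment is \<open>O(\<bar>\<xi>\<bar> powr (- s * q))\<close>. For \<open>t < s\<close> and \<open>q\<close> large the moments of
  the transform times \<open>\<bar>\<xi>\<bar> powr (t / 2)\<close> are summable along \<open>\<xi> = sqrt n\<close>, and the Lipschitz
  continuity of the transform gives the decay at all \<open>\<xi>\<close>.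
\<close>

section \<open>Parity weights\<close>

text \<open>This dominates the modulus of the average over \<open>\<omega>\<close> of an exponential
  with odd coefficients at the points \<open>x j\<close>, \<open>j \<in> A\<close>. The index set is
  a parameter so that pairs of points can be removed one after the other.\<close>

definition parity_weight :: "real set set \<Rightarrow> real \<Rightarrow> nat set \<Rightarrow> (nat \<Rightarrow> real) \<Rightarrow> real" where
  "parity_weight F \<epsilon> A x = (\<Prod>U\<in>F. if odd (card {j\<in>A. U \<subseteq> {..<x j}}) then \<epsilon> else 1)"

text \<open>One factor \<open>\<epsilon>\<close> for each gap of \<open>F\<close> crossed on the way
  from \<open>x\<close> to \<open>y\<close>. The condition at \<open>x\<close> is the negation of
  lying below \<open>x\<close>, rather than lying above it, so that comparisons with
  \<open>parity_weight\<close> hold for arbitrary real points.\<close>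

definition crossing_weight :: "real set set \<Rightarrow> real \<Rightarrow> real \<Rightarrow> real \<Rightarrow> real" where
  "crossing_weight F \<epsilon> x y = (\<Prod>U\<in>F. if \<not> U \<subseteq> {..<x} \<and> U \<subseteq> {..<y} then \<epsilon> else 1)"

lemma parity_weight_nonneg: "0 \<le> \<epsilon> \<Longrightarrow> 0 \<le> parity_weight F \<epsilon> A x"
  by (auto simp: parity_weight_def intro!: prod_nonneg)

lemma crossing_weight_nonneg: "0 \<le> \<epsilon> \<Longrightarrow> 0 \<le> crossing_weight F \<epsilon> x y"
  by (auto simp: crossing_weight_def intro!: prod_nonneg)

lemma parity_weight_le_one: "0 \<le> \<epsilon> \<Longrightarrow> \<epsilon> \<le> 1 \<Longrightarrow> parity_weight F \<epsilon> A x \<le> 1"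
  by (auto simp: parity_weight_def intro!: prod_le_1)

lemma parity_weight_empty [simp]: "parity_weight F \<epsilon> {} x = 1"
  by (simp add: parity_weight_def)

lemma parity_weight_cong:
  "(\<And>j. j \<in> A \<Longrightarrow> x j = y j) \<Longrightarrow> parity_weight F \<epsilon> A x = parity_weight F \<epsilon> A y"
proof -
  assume "\<And>j. j \<in> A \<Longrightarrow> x j = y j"
  then have "{j\<in>A. U \<subseteq> {..<x j}} = {j\<in>A. U \<subseteq> {..<y j}}" for U by auto
  then show ?thesis unfolding parity_weight_def by simp
qed

text \<open>The pair consists of the two smallest points: a gap between them lies below all the other
  points and not below the smallest, hence below an odd number of points of \<open>A\<close> and an even number
  of the remaining ones.\<close>

lemma parity_weight_le_crossing_weight:
  assumes \<epsilon>: "0 \<le> \<epsilon>" "\<epsilon> \<le> 1"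
    and A: "finite A" "even (card A)" "A \<noteq> {}"
  shows "\<exists>i\<in>A. \<exists>j\<in>A - {i}. x i \<le> x j \<and>
    parity_weight F \<epsilon> A x \<le> crossing_weight F \<epsilon> (x i) (x j) * parity_weight F \<epsilon> (A - {i, j}) x"
proof -
  obtain i where i: "i \<in> A" "\<And>k. k \<in> A \<Longrightarrow> x i \<le> x k"
    using A ex_min_if_finite[of "x ` A"] by (metis (no_types, lifting) arg_min_if_finite(1) arg_min_least)
  have "A - {i} \<noteq> {}"
  proof
    assume "A - {i} = {}"
    then have "A = {i}" using i by auto
    then show False using A by simp
  qed
  then obtain j where j: "j \<in> A - {i}" "\<And>k. k \<in> A - {i} \<Longrightarrow> x j \<le> x k"
    using A by (metis (no_types, lifting) arg_min_if_finite(1) arg_min_least finite_Diff)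
  define B where "B = A - {i, j}"
  have AB: "A = insert i (insert j B)" "i \<notin> insert j B" "j \<notin> B" "finite B" 
    using i j A by (auto simp: B_def)
  have evB: "even (card B)" using A AB by simp
  have ij: "x i \<le> x j" using i j by auto
  have "(if odd (card {k\<in>A. U \<subseteq> {..<x k}}) then \<epsilon> else 1)
    \<le> (if \<not> U \<subseteq> {..<x i} \<and> U \<subseteq> {..<x j} then \<epsilon> else 1) *
       (if odd (card {k\<in>B. U \<subseteq> {..<x k}}) then \<epsilon> else 1)" (is "?l \<le> ?r") for U
  proof -
    have mono: "U \<subseteq> {..<u} \<Longrightarrow> u \<le> v \<Longrightarrow> U \<subseteq> {..<v}" for u v :: real by force
    show ?thesis
    proof (cases "U \<subseteq> {..<x j}")
      case True
      have "U \<subseteq> {..<x k}" if "k \<in> B" for k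
        using mono[OF True, of "x k"] j(2)[of k] that by (auto simp: B_def)
      then have BB: "{k\<in>B. U \<subseteq> {..<x k}} = B" by auto
      have "{k\<in>A. U \<subseteq> {..<x k}} = (if U \<subseteq> {..<x i} then insert i (insert j B) else insert j B)"
        using True BB AB(1,2) by auto
      then show ?thesis using \<epsilon> evB AB BB True by auto
    next
      case False
      then have "\<not> U \<subseteq> {..<x i}" using mono ij by blast
      then have "{k\<in>A. U \<subseteq> {..<x k}} = {k\<in>B. U \<subseteq> {..<x k}}" 
        using False AB(1) by auto
      then show ?thesis using \<epsilon> False by auto
    qed
  qed
  then have "parity_weight F \<epsilon> A x \<le> crossing_weight F \<epsilon> (x i) (x j) * parity_weight F \<epsilon> B x"
    unfolding parity_weight_def crossing_weight_def prod.distrib[symmetric]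
    using \<epsilon> by (intro prod_mono) auto
  then show ?thesis using i j ij unfolding B_def by blast
qed

text \<open>The condition is monotone in \<open>x\<close> for any set \<open>U\<close>, so its
  indicator is a monotone function and therefore Borel.\<close>

lemma measurable_below [measurable]: "Measurable.pred borel (\<lambda>x::real. U \<subseteq> {..<x})"
proof -
  have "(\<lambda>x. of_bool (U \<subseteq> {..<x}) :: real) \<in> borel_measurable borel"
    by (intro borel_measurable_mono monoI) (force simp: of_bool_def)
  then have "Measurable.pred borel (\<lambda>x. of_bool (U \<subseteq> {..<x}) = (1::real))"
    by measurable
  then show ?thesis by simp
qed

lemma measurable_ident_restrict:
  fixes E :: "real set"
  shows "sets M = sets (restrict_space borel E) \<Longrightarrow> (\<lambda>x. x) \<in> measurable M borel"
  using measurable_restrict_space1[of "\<lambda>x. x" borel borel E]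
  by (simp cong: measurable_cong_sets)

lemma measurable_crossing_weight [measurable]:
  assumes [measurable]: "f \<in> borel_measurable M" "g \<in> borel_measurable M" 
  shows "(\<lambda>z. crossing_weight F \<epsilon> (f z) (g z)) \<in> borel_measurable M"
  unfolding crossing_weight_def by measurable

lemma measurable_parity_weight:
  assumes [measurable]: "\<And>j. j \<in> A \<Longrightarrow> (\<lambda>x. x j) \<in> borel_measurable M"
  shows "parity_weight F \<epsilon> A \<in> borel_measurable M"
proof -
  have "Measurable.pred M (\<lambda>x. j \<in> {j\<in>A. U \<subseteq> {..<x j}})" for U j
    by (cases "j \<in> A") auto
  then have [measurable]: "(\<lambda>x. card {j\<in>A. U \<subseteq> {..<x j}}) \<in> measurable M (count_space UNIV)" for U
    by (intro measurable_card) (simp add: pred_def)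
  show ?thesis unfolding parity_weight_def[abs_def] by measurable
qed

text \<open>Induction on the number of pairs. The pair split off depends on \<open>x\<close>, so the
  integrand is bounded by the sum over all ordered pairs of distinct indices. There are at most
  \<open>N^2\<close> of them, where \<open>N\<close> stays fixed while \<open>A\<close>
  shrinks.\<close>

proposition nn_integral_parity_weight_le:
  fixes lam :: "real measure" and K :: ennreal
  assumes lam: "prob_space lam" "(\<lambda>x. x) \<in> borel_measurable lam"
    and \<epsilon>: "0 \<le> \<epsilon>" "\<epsilon> \<le> 1"
    and K: "\<And>x. x \<in> space lam \<Longrightarrow>
      (\<integral>\<^sup>+y. (if x \<le> y then ennreal (crossing_weight F \<epsilon> x y) else 0) \<partial>lam) \<le> K"
    and A: "finite A" "card A = 2 * q" "card A \<le> N"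
  shows "(\<integral>\<^sup>+x. ennreal (parity_weight F \<epsilon> A x) \<partial>(Pi\<^sub>M A (\<lambda>_. lam))) \<le> (of_nat (N^2) * K) ^ q"
  using A
proof (induction q arbitrary: A)
  case 0
  then have "A = {}" by simp
  interpret prob_space "Pi\<^sub>M A (\<lambda>_. lam)" using lam(1) by (intro prob_space_PiM)
  show ?case using \<open>A = {}\<close> emeasure_space_1 by simp
next
  case (Suc q)
  interpret prob_space lam by (rule lam(1))
  interpret product_prob_space "\<lambda>_::nat. lam" by standard
  have comp: "(\<lambda>x. x j) \<in> borel_measurable (Pi\<^sub>M I (\<lambda>_. lam))" if "j \<in> I" for j I
    using measurable_compose[OF measurable_component_singleton[OF that, of "\<lambda>_. lam"] lam(2)] .
  define g where "g x y = (if x \<le> y then ennreal (crossing_weight F \<epsilon> x y) else 0)" for x y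
  have g_meas: "(\<lambda>z. g (f z) (h z)) \<in> borel_measurable M"
    if f: "f \<in> borel_measurable M" and h: "h \<in> borel_measurable M"
    for f h and M :: "(nat \<Rightarrow> real) measure"
    unfolding g_def
    by (intro measurable_If measurable_compose[OF measurable_crossing_weight[OF f h] measurable_ennreal]
        measurable_const borel_measurable_le f h) auto
  have g_meas1: "g c \<in> borel_measurable lam" for c
    unfolding g_def
    by (intro measurable_If measurable_compose[OF measurable_crossing_weight[OF _ lam(2)] measurable_ennreal]
        measurable_const borel_measurable_le lam(2)) auto
  have w_meas: "(\<lambda>x. ennreal (parity_weight F \<epsilon> B x)) \<in> borel_measurable (Pi\<^sub>M I (\<lambda>_. lam))"
    if "B \<subseteq> I" for B I
    using that by (intro measurable_compose[OF _ measurable_ennreal] measurable_parity_weight comp) auto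
  define S where "S = Sigma A (\<lambda>i. A - {i})"
  have S: "finite S" "card S \<le> N^2"
  proof -
    show "finite S" using Suc.prems by (auto simp: S_def)
    have "card S \<le> card (A \<times> A)" unfolding S_def using Suc.prems by (intro card_mono) auto
    also have "\<dots> = (card A)^2" by (simp add: card_cartesian_product power2_eq_square)
    also have "\<dots> \<le> N^2" using Suc.prems by (intro power_mono) auto
    finally show "card S \<le> N^2" .
  qed
  have pt: "ennreal (parity_weight F \<epsilon> A x)
     \<le> (\<Sum>(i,j)\<in>S. g (x i) (x j) * ennreal (parity_weight F \<epsilon> (A - {i,j}) x))" for x
  proof -
    have "A \<noteq> {}" using Suc.prems by auto
    obtain i j where ij: "i \<in> A" "j \<in> A - {i}" "x i \<le> x j"
      "parity_weight F \<epsilon> A x \<le> crossing_weight F \<epsilon> (x i) (x j) * parity_weight F \<epsilon> (A - {i, j}) x"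
      using parity_weight_le_crossing_weight[OF \<epsilon>, of A x F] Suc.prems \<open>A \<noteq> {}\<close> by auto
    have "ennreal (parity_weight F \<epsilon> A x) 
      \<le> ennreal (crossing_weight F \<epsilon> (x i) (x j)) * ennreal (parity_weight F \<epsilon> (A - {i, j}) x)"
      using ennreal_leI[OF ij(4)] \<epsilon> by (simp add: ennreal_mult crossing_weight_nonneg parity_weight_nonneg)
    also have "\<dots> = (case (i,j) of (i,j) \<Rightarrow> g (x i) (x j) * ennreal (parity_weight F \<epsilon> (A - {i,j}) x))"
      using ij by (simp add: g_def)
    also have "\<dots> \<le> (\<Sum>(i,j)\<in>S. g (x i) (x j) * ennreal (parity_weight F \<epsilon> (A - {i,j}) x))"
      using ij S by (intro member_le_sum) (auto simp: S_def)
    finally show ?thesis .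
  qed
  have pair: "(\<integral>\<^sup>+x. g (x i) (x j) * ennreal (parity_weight F \<epsilon> (A - {i,j}) x) \<partial>Pi\<^sub>M A (\<lambda>_. lam))
     \<le> K * (of_nat (N^2) * K) ^ q" if "(i,j) \<in> S" for i j
  proof -
    define B where "B = A - {i,j}"
    \<comment> \<open>Inserting \<open>j\<close> last makes \<open>x j\<close> the inner variable.
      With \<open>x i\<close> fixed, its integral is at most \<open>K\<close>; the remaining weight
      depends on neither coordinate, so integrating out \<open>x i\<close> costs nothing.\<close>
    have B: "A = insert j (insert i B)" "finite B" "i \<notin> B" "j \<notin> B" "j \<noteq> i"
      using that Suc.prems by (auto simp: B_def S_def)
    have "(\<integral>\<^sup>+x. g (x i) (x j) * ennreal (parity_weight F \<epsilon> B x) \<partial>Pi\<^sub>M A (\<lambda>_. lam))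
      = (\<integral>\<^sup>+x. (\<integral>\<^sup>+y. g (x i) y * ennreal (parity_weight F \<epsilon> B (x(j := y))) \<partial>lam) \<partial>Pi\<^sub>M (insert i B) (\<lambda>_. lam))"
      unfolding B(1) using B
      by (subst product_nn_integral_insert) (auto intro!: borel_measurable_times_ennreal g_meas comp w_meas)
    also have "\<dots> = (\<integral>\<^sup>+x. (\<integral>\<^sup>+y. g (x i) y \<partial>lam) * ennreal (parity_weight F \<epsilon> B x) \<partial>Pi\<^sub>M (insert i B) (\<lambda>_. lam))"
    proof -
      have "parity_weight F \<epsilon> B (x(j := y)) = parity_weight F \<epsilon> B x" for x y
        using B by (intro parity_weight_cong) auto
      then show ?thesis by (simp add: nn_integral_multc g_meas1)
    qed
    also have "\<dots> \<le> (\<integral>\<^sup>+x. K * ennreal (parity_weight F \<epsilon> B x) \<partial>Pi\<^sub>M (insert i B) (\<lambda>_. lam))"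
      by (intro nn_integral_mono mult_right_mono) (auto simp: g_def space_PiM intro!: K)
    also have "\<dots> = K * (\<integral>\<^sup>+x. ennreal (parity_weight F \<epsilon> B x) \<partial>Pi\<^sub>M (insert i B) (\<lambda>_. lam))"
      by (intro nn_integral_cmult) (auto intro!: w_meas)
    finally have le: "(\<integral>\<^sup>+x. g (x i) (x j) * ennreal (parity_weight F \<epsilon> B x) \<partial>Pi\<^sub>M A (\<lambda>_. lam))
      \<le> K * (\<integral>\<^sup>+x. ennreal (parity_weight F \<epsilon> B x) \<partial>Pi\<^sub>M (insert i B) (\<lambda>_. lam))" .
    have "(\<integral>\<^sup>+x. ennreal (parity_weight F \<epsilon> B x) \<partial>Pi\<^sub>M (insert i B) (\<lambda>_. lam))
      = (\<integral>\<^sup>+x. (\<integral>\<^sup>+y. ennreal (parity_weight F \<epsilon> B (x(i := y))) \<partial>lam) \<partial>Pi\<^sub>M B (\<lambda>_. lam))"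
      using B by (subst product_nn_integral_insert) (auto intro!: w_meas)
    also have "\<dots> = (\<integral>\<^sup>+x. ennreal (parity_weight F \<epsilon> B x) \<partial>Pi\<^sub>M B (\<lambda>_. lam))"
    proof -
      have "parity_weight F \<epsilon> B (x(i := y)) = parity_weight F \<epsilon> B x" for x y
        using B by (intro parity_weight_cong) auto
      then show ?thesis by (simp add: prob_space.emeasure_space_1[OF lam(1)])
    qed
    also have "\<dots> \<le> (of_nat (N^2) * K) ^ q"
      using Suc.prems B by (intro Suc.IH) auto
    finally show ?thesis using order_trans[OF le mult_left_mono] unfolding B_def by simp
  qed
  have "(\<integral>\<^sup>+x. ennreal (parity_weight F \<epsilon> A x) \<partial>(Pi\<^sub>M A (\<lambda>_. lam)))
    \<le> (\<integral>\<^sup>+x. (\<Sum>p\<in>S. g (x (fst p)) (x (snd p)) * ennreal (parity_weight F \<epsilon> (A - {fst p,snd p}) x)) \<partial>(Pi\<^sub>M A (\<lambda>_. lam)))"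
    using pt by (intro nn_integral_mono) (auto simp: case_prod_beta)
  also have "\<dots> = (\<Sum>p\<in>S. \<integral>\<^sup>+x. g (x (fst p)) (x (snd p)) * ennreal (parity_weight F \<epsilon> (A - {fst p,snd p}) x) \<partial>(Pi\<^sub>M A (\<lambda>_. lam)))"
    by (intro nn_integral_sum borel_measurable_times_ennreal g_meas comp w_meas)
       (auto simp: S_def)
  also have "\<dots> \<le> (\<Sum>p\<in>S. K * (of_nat (N^2) * K) ^ q)"
    by (intro sum_mono pair) simp
  also have "\<dots> = of_nat (card S) * (K * (of_nat (N^2) * K) ^ q)" by simp
  also have "\<dots> \<le> of_nat (N^2) * (K * (of_nat (N^2) * K) ^ q)"
    using S by (intro mult_right_mono) (auto simp flip: of_nat_power)
  also have "\<dots> = (of_nat (N^2) * K) ^ Suc q" by (simp add: mult_ac)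
  finally show ?case .
qed

section \<open>The crossing integral\<close>

lemma sets_restrict_borelI:
  assumes "sets M = sets (restrict_space borel E)" "A \<in> sets borel"
  shows "A \<inter> E \<in> sets M"
  using assms by (auto simp: sets_restrict_space)

lemma space_restrict_borel:
  fixes E :: "real set"
  shows "sets M = sets (restrict_space borel E) \<Longrightarrow> space M = E"
  using sets_eq_imp_space_eq[of M "restrict_space borel E"] by (simp add: space_restrict_space)

text \<open>The measure of \<open>{x..y}\<close> grows with \<open>y\<close>, so these
  \<open>y\<close> form an initial segment of the part of \<open>E\<close> from \<open>x\<close> on.
  Asking only for a measurable superset \<open>T\<close> of small measure avoids a separate
  measurability proof for the segment itself.\<close>

lemma initial_segment_measure_le:
  fixes lam :: "real measure" and E :: "real set"
  assumes lam: "prob_space lam" "sets lam = sets (restrict_space borel E)"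
    and E: "bounded E" and t: "0 \<le> t"
  shows "\<exists>T\<in>sets lam. {y\<in>E. x \<le> y \<and> measure lam ({x..y} \<inter> E) \<le> t} \<subseteq> T \<and> emeasure lam T \<le> ennreal t"
proof -
  interpret prob_space lam by (rule lam(1))
  define S where "S = {y\<in>E. x \<le> y \<and> measure lam ({x..y} \<inter> E) \<le> t}"
  have sets: "A \<inter> E \<in> sets lam" if "A \<in> sets borel" for A
    using sets_restrict_borelI[OF lam(2) that] .
  show ?thesis
  proof (cases "S = {}")
    case True
    then show ?thesis unfolding S_def[symmetric] using t by (intro bexI[of _ "{}"]) auto
  next
    case False
    have bdd: "bdd_above S"
      using E bounded_imp_bdd_above bdd_above_mono[of E S] by (auto simp: S_def)
    define c where "c = Sup S"
    have le: "y \<le> c" if "y \<in> S" for y unfolding c_def using bdd that by (rule cSup_upper[rotated])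
    show ?thesis
    proof (cases "c \<in> S")
      case True
      show ?thesis unfolding S_def[symmetric]
        using True le sets[of "{x..c}"]
        by (intro bexI[of _ "{x..c} \<inter> E"]) (auto simp: S_def emeasure_eq_measure intro!: ennreal_leI)
    next
      case notin: False
      \<comment> \<open>When the supremum \<open>c\<close> is not attained, these sets increase to a
        set containing \<open>S\<close>. Each of them lies in \<open>{x..y}\<close> for some
        \<open>y \<in> S\<close>, so the bound \<open>t\<close> passes to the union.\<close>
      define A where "A n = {x..c - 1 / Suc n} \<inter> E" for n :: nat
      have A_sets: "range A \<subseteq> sets lam" unfolding A_def using sets by auto
      have "incseq A"
      proof (rule monoI)
        fix m n :: nat assume "m \<le> n"
        then have "c - 1 / Suc m \<le> c - 1 / Suc n" by (simp add: frac_le)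
        then show "A m \<le> A n" unfolding A_def by (auto intro: order_trans)
      qed
      have A_le: "measure lam (A n) \<le> t" for n
      proof -
        obtain y where y: "y \<in> S" "c - 1 / Suc n < y"
          using less_cSup_iff[OF False bdd, of "c - 1 / Suc n"] by (auto simp: c_def)
        have "measure lam (A n) \<le> measure lam ({x..y} \<inter> E)"
          using y sets by (intro finite_measure_mono) (auto simp: A_def)
        also have "\<dots> \<le> t" using y by (simp add: S_def)
        finally show ?thesis .
      qed
      have "(\<lambda>n. measure lam (A n)) \<longlonglongrightarrow> measure lam (\<Union>n. A n)"
        by (rule finite_Lim_measure_incseq[OF A_sets \<open>incseq A\<close>])
      then have "measure lam (\<Union>n. A n) \<le> t"
        by (rule LIMSEQ_le_const2) (use A_le in auto)
      moreover have "S \<subseteq> (\<Union>n. A n)"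
      proof
        fix y assume y: "y \<in> S"
        then have "0 < c - y" using le[of y] notin by (cases "y = c") auto
        then obtain n where "inverse (real (Suc n)) < c - y" using reals_Archimedean by blast
        then have "y \<in> A n" using y by (auto simp: A_def S_def inverse_eq_divide)
        then show "y \<in> (\<Union>n. A n)" by blast
      qed
      moreover have "(\<Union>n. A n) \<in> sets lam" using A_sets by auto
      ultimately show ?thesis unfolding S_def[symmetric]
        by (intro bexI[of _ "\<Union>n. A n"]) (auto simp: emeasure_eq_measure intro!: ennreal_leI)
    qed
  qed
qed

lemma crossing_weight_power:
  "finite F \<Longrightarrow> crossing_weight F \<epsilon> x y = \<epsilon> ^ card (F \<inter> {U. \<not> U \<subseteq> {..<x} \<and> U \<subseteq> {..<y}})"
  unfolding crossing_weight_def by (simp add: prod.If_cases)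

text \<open>A gap inside \<open>{x..y}\<close> is non-empty and misses the point \<open>y\<close> of
  \<open>E\<close>, so it lies strictly below \<open>y\<close> but not below \<open>x\<close>. Hence
  every counted gap is crossed, and \<open>\<epsilon> \<le> 1\<close> turns the larger exponent into
  a smaller power.\<close>

lemma crossing_weight_le_gap_count:
  assumes "finite F" "F = {U \<in> bounded_gaps E. inverse X \<le> \<delta> U}"
    and "0 \<le> \<epsilon>" "\<epsilon> \<le> 1" "y \<in> E"
  shows "crossing_weight F \<epsilon> x y \<le> \<epsilon> ^ gap_count E \<delta> {x..y} X"
proof -
  have "{U \<in> bounded_gaps E. U \<subseteq> {x..y} \<and> inverse X \<le> \<delta> U}
      \<subseteq> F \<inter> {U. \<not> U \<subseteq> {..<x} \<and> U \<subseteq> {..<y}}"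
  proof
    fix U assume U: "U \<in> {U \<in> bounded_gaps E. U \<subseteq> {x..y} \<and> inverse X \<le> \<delta> U}"
    then have "U \<subseteq> - E" "U \<noteq> {}"
      using in_components_subset in_components_nonempty by (auto simp: bounded_gaps_def)
    then have "y \<notin> U" using assms(5) by auto
    have "U \<subseteq> {..<y}"
    proof
      fix u assume "u \<in> U"
      with U \<open>y \<notin> U\<close> have "u \<le> y" "u \<noteq> y" by auto
      then show "u \<in> {..<y}" by simp
    qed
    moreover have "\<not> U \<subseteq> {..<x}" using U \<open>U \<noteq> {}\<close> by force
    ultimately show "U \<in> F \<inter> {U. \<not> U \<subseteq> {..<x} \<and> U \<subseteq> {..<y}}" using U assms(2) by auto
  qed
  then have "gap_count E \<delta> {x..y} X \<le> card (F \<inter> {U. \<not> U \<subseteq> {..<x} \<and> U \<subseteq> {..<y}})"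
    unfolding gap_count_def using assms(1) by (intro card_mono) auto
  then show ?thesis
    using assms by (simp add: crossing_weight_power power_decreasing)
qed

lemma half_exp_le_one:
  fixes b :: real
  assumes "0 < b"
  shows "exp (- 1 / b) / 2 \<le> 1"
proof -
  have "exp (- 1 / b) \<le> exp 0" using assms by (subst exp_le_cancel_iff) simp
  then have "exp (- 1 / b) \<le> 1" by (simp only: exp_zero)
  then show ?thesis by linarith
qed

text \<open>If exactly \<open>n\<close> of the gaps counted by \<open>gap_count\<close> lie in \<open>{x..y}\<close>, the hypothesis bounds
  the measure of \<open>{x..y}\<close> by \<open>t n = exp ((n - a) / b) * X powr (- s)\<close>, and the set of such \<open>y\<close> has
  measure at most \<open>t n\<close>. The choice of \<open>\<epsilon>\<close> makes the sum of \<open>\<epsilon> ^ n * t n\<close> geometric.\<close>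

proposition nn_integral_crossing_weight_le:
  fixes lam :: "real measure" and E :: "real set"
  assumes lam: "prob_space lam" "sets lam = sets (restrict_space borel E)"
    and E: "bounded E"
    and b: "0 < b" and X: "0 < X"
    and F: "finite F" "F = {U \<in> bounded_gaps E. inverse X \<le> \<delta> U}"
    and \<epsilon>: "\<epsilon> = exp (- 1 / b) / 2"
    and gaps: "\<And>J. is_interval J \<Longrightarrow> 0 < measure lam (J \<inter> E) \<Longrightarrow>
           a + b * (ln (measure lam (J \<inter> E)) + s * ln X) \<le> real (gap_count E \<delta> J X)"
  shows "(\<integral>\<^sup>+y. (if x \<le> y then ennreal (crossing_weight F \<epsilon> x y) else 0) \<partial>lam)
    \<le> ennreal (2 * exp (- a / b) * X powr (- s))"
proof -
  interpret prob_space lam by (rule lam(1))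
  have \<epsilon>01: "0 \<le> \<epsilon>" "\<epsilon> \<le> 1"
    unfolding \<epsilon> using half_exp_le_one[OF b] by simp_all
  define t where "t n = exp ((real n - a) / b) * X powr (- s)" for n
  have t_nonneg: "0 \<le> t n" for n by (simp add: t_def)
  define T where "T n = (SOME T. T \<in> sets lam \<and>
    {y\<in>E. x \<le> y \<and> measure lam ({x..y} \<inter> E) \<le> t n} \<subseteq> T \<and> emeasure lam T \<le> ennreal (t n))" for n
  have T: "T n \<in> sets lam \<and> {y\<in>E. x \<le> y \<and> measure lam ({x..y} \<inter> E) \<le> t n} \<subseteq> T n \<and>
    emeasure lam (T n) \<le> ennreal (t n)" for n
    using initial_segment_measure_le[OF lam E t_nonneg[of n], of x]
    unfolding T_def Bex_def by (rule someI_ex)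
  have pt: "(if x \<le> y then ennreal (crossing_weight F \<epsilon> x y) else 0)
    \<le> (\<Sum>n. ennreal (\<epsilon> ^ n) * indicator (T n) y)" if y: "y \<in> space lam" for y
  proof (cases "x \<le> y")
    case True
    have yE: "y \<in> E" using y space_restrict_borel[OF lam(2)] by simp
    define n where "n = gap_count E \<delta> {x..y} X"
    define m where "m = measure lam ({x..y} \<inter> E)"
    have "m \<le> t n"
    \<comment> \<open>The hypothesis \<open>gaps\<close> speaks only of positive measure; for
      \<open>m = 0\<close> the bound holds because \<open>t n\<close> is non-negative.\<close>
    proof (cases "m > 0")
      case True
      have "a + b * (ln m + s * ln X) \<le> real n"
        unfolding m_def n_def by (rule gaps) (use True in \<open>auto simp: m_def is_interval_cc\<close>)
      then have "ln m \<le> (real n - a) / b - s * ln X"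
        using b by (simp add: field_simps)
      then have "exp (ln m) \<le> exp ((real n - a) / b - s * ln X)" by (subst exp_le_cancel_iff)
      then show ?thesis using True X by (simp add: t_def powr_def exp_diff exp_minus field_simps)
    next
      case False
      have "0 \<le> t n" by (simp add: t_def)
      then show ?thesis using False by linarith
    qed
    then have "y \<in> T n" using T[of n] True yE by (auto simp: m_def)
    have "ennreal (crossing_weight F \<epsilon> x y) \<le> ennreal (\<epsilon> ^ n) * indicator (T n) y"
      using crossing_weight_le_gap_count[OF F \<epsilon>01 yE] \<open>y \<in> T n\<close> by (simp add: n_def ennreal_leI)
    also have "\<dots> \<le> (\<Sum>n. ennreal (\<epsilon> ^ n) * indicator (T n) y)"
    proof -
      have "sum f {n} \<le> suminf f" for f :: "nat \<Rightarrow> ennreal" by (intro sum_le_suminf) auto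
      then show ?thesis by simp
    qed
    finally show ?thesis using True by simp
  qed auto
  have "(\<integral>\<^sup>+y. (if x \<le> y then ennreal (crossing_weight F \<epsilon> x y) else 0) \<partial>lam)
     \<le> (\<integral>\<^sup>+y. (\<Sum>n. ennreal (\<epsilon> ^ n) * indicator (T n) y) \<partial>lam)"
    by (intro nn_integral_mono pt)
  also have "\<dots> = (\<Sum>n. ennreal (\<epsilon> ^ n) * emeasure lam (T n))"
  proof -
    have [measurable]: "T n \<in> sets lam" for n using T by blast
    have "(\<integral>\<^sup>+y. ennreal (\<epsilon> ^ n) * indicator (T n) y \<partial>lam) = ennreal (\<epsilon> ^ n) * emeasure lam (T n)" for n
      by (subst nn_integral_cmult) auto
    then show ?thesis by (subst nn_integral_suminf) auto
  qed
  also have "\<dots> \<le> (\<Sum>n. ennreal (exp (- a / b) * X powr (- s) * (1/2) ^ n))"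
  proof (intro suminf_le summableI)
    fix n
    have "exp ((real n - a) / b) = exp (- a / b) * exp (1 / b) ^ n"
      by (simp add: exp_of_nat_mult[symmetric] exp_add[symmetric] diff_divide_distrib)
    moreover have "\<epsilon> ^ n * exp (1 / b) ^ n = (1/2) ^ n"
      by (simp add: \<epsilon> power_mult_distrib[symmetric] exp_minus)
    ultimately have "\<epsilon> ^ n * t n = exp (- a / b) * X powr (- s) * (1/2) ^ n"
      unfolding t_def by (metis (no_types, lifting) mult.assoc mult.commute)
    then have "ennreal (\<epsilon> ^ n) * ennreal (t n) = ennreal (exp (- a / b) * X powr (- s) * (1/2) ^ n)"
      using \<epsilon>01 by (simp add: ennreal_mult[symmetric] t_def)
    then show "ennreal (\<epsilon> ^ n) * emeasure lam (T n) \<le> ennreal (exp (- a / b) * X powr (- s) * (1/2) ^ n)"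
      using T[of n] mult_left_mono[of "emeasure lam (T n)" "ennreal (t n)" "ennreal (\<epsilon> ^ n)"] by simp
  qed
  also have "\<dots> = ennreal (exp (- a / b) * X powr (- s) * 2)"
  proof -
    have "(\<lambda>n. exp (- a / b) * X powr (- s) * (1/2) ^ n) sums (exp (- a / b) * X powr (- s) * (1 / (1 - 1/2)))"
      by (intro sums_mult geometric_sums) auto
    then show ?thesis
      by (subst suminf_ennreal2) (auto simp: sums_iff)
  qed
  finally show ?thesis by (simp add: mult_ac)
qed

section \<open>Averaging over the perturbation\<close>

text \<open>The components of an open set are disjoint and open, so there are only countably
  many.\<close>

lemma countable_bounded_gaps: "closed E \<Longrightarrow> countable (bounded_gaps E)"
proof -
  assume "closed E"
  have "countable (components (- E))"
  proof (rule countable_disjoint_open_subsets)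
    show "open S" if "S \<in> components (- E)" for S
      using \<open>closed E\<close> that by (auto intro: open_components)
    show "disjoint (components (- E))"
      using pairwise_disjoint_components[of "- E"] by (simp add: disjnt_def pairwise_def)
  qed
  then show ?thesis unfolding bounded_gaps_def by (rule countable_subset[rotated]) auto
qed

section \<open>Exponentials and the Fourier transform\<close>

lemma borel_measurable_cis [measurable]: "cis \<in> borel_measurable borel"
  by (intro borel_measurable_continuous_onI continuous_intros)

lemma cis_sum: "cis (\<Sum>i\<in>A. f i) = (\<Prod>i\<in>A. cis (f i))"
  by (induction A rule: infinite_finite_induct) (auto simp: cis_mult[symmetric])

lemma fourier_transform_cis: "fourier_transform \<mu> \<xi> = (\<integral>x. cis (- (2 * pi * \<xi>) * x) \<partial>\<mu>)"
proof -
  have "exp (- (2 * of_real pi * \<i> * of_real \<xi> * of_real x)) = cis (- (2 * pi * \<xi>) * x)" for x :: real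
    by (simp add: cis_conv_exp mult_ac)
  then show ?thesis by (simp add: fourier_transform_def)
qed

lemma norm_fourier_transform_le_one:
  assumes "prob_space \<mu>"
  shows "cmod (fourier_transform \<mu> \<xi>) \<le> 1"
proof -
  interpret prob_space \<mu> by fact
  have "cmod (fourier_transform \<mu> \<xi>) \<le> (\<integral>x. norm (cis (- (2 * pi * \<xi>) * x)) \<partial>\<mu>)"
    unfolding fourier_transform_cis by (rule integral_norm_bound)
  then show ?thesis by (simp add: prob_space)
qed

lemma (in prob_space) integrable_cis:
  "f \<in> borel_measurable M \<Longrightarrow> integrable M (\<lambda>x. cis (f x))"
  by (intro integrable_const_bound[of _ 1]) auto

definition gap_dist :: "(real set \<Rightarrow> real) \<Rightarrow> real measure \<Rightarrow> real set \<Rightarrow> real measure" where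
  "gap_dist \<delta> \<nu> U = distr \<nu> (restrict_space borel {0..\<delta> U}) (\<lambda>x. \<delta> U * x)"

text \<open>Non-negativity of \<open>\<delta>\<close> is assumed on all sets, not only on the gaps,
  which spares a membership condition at each use. The final theorem arranges this by changing
  \<open>\<delta>\<close> off the gaps.\<close>

locale gap_perturbation =
  fixes E :: "real set" and \<delta> :: "real set \<Rightarrow> real" and \<nu> lam :: "real measure"
  assumes compact_E: "compact E"
    and \<delta>_nonneg: "\<And>U. 0 \<le> \<delta> U"
    and \<delta>_summable: "\<delta> summable_on bounded_gaps E"
    and prob_\<nu>: "prob_space \<nu>" and sets_\<nu>: "sets \<nu> = sets (restrict_space borel {0..1})"
    and prob_lam: "prob_space lam" and sets_lam: "sets lam = sets (restrict_space borel E)"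
begin

abbreviation P where "P \<equiv> perturbation_measure E \<delta> \<nu>"

lemma P_eq: "P = Pi\<^sub>M (bounded_gaps E) (gap_dist \<delta> \<nu>)"
  unfolding perturbation_measure_def gap_dist_def ..

lemma scale_measurable: "(\<lambda>x. \<delta> U * x) \<in> measurable \<nu> (restrict_space borel {0..\<delta> U})"
proof (rule measurable_restrict_space2)
  show "(\<lambda>x. \<delta> U * x) \<in> borel_measurable \<nu>"
    using measurable_ident_restrict[OF sets_\<nu>] by measurable
  show "(\<lambda>x. \<delta> U * x) \<in> space \<nu> \<rightarrow> {0..\<delta> U}"
    using \<delta>_nonneg[of U] space_restrict_borel[OF sets_\<nu>] by (auto intro: mult_left_le)
qed

lemma prob_gap_dist: "prob_space (gap_dist \<delta> \<nu> U)"
  unfolding gap_dist_def by (rule prob_space.prob_space_distr[OF prob_\<nu> scale_measurable])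

lemma prob_P: "prob_space P"
  unfolding P_eq by (intro prob_space_PiM prob_gap_dist)

lemma gap_dist_measurable: "(\<lambda>x. x) \<in> borel_measurable (gap_dist \<delta> \<nu> U)"
  by (rule measurable_ident_restrict[of _ "{0..\<delta> U}"]) (simp add: gap_dist_def)

lemma P_component:
  assumes "U \<in> bounded_gaps E"
  shows "(\<lambda>\<omega>. \<omega> U) \<in> borel_measurable P"
  unfolding P_eq
  using measurable_compose[OF measurable_component_singleton[OF assms, of "gap_dist \<delta> \<nu>"]
      gap_dist_measurable[of U]] .

lemma P_spaceD: "\<omega> \<in> space P \<Longrightarrow> U \<in> bounded_gaps E \<Longrightarrow> 0 \<le> \<omega> U \<and> \<omega> U \<le> \<delta> U"
  unfolding space_perturbation_measure by (auto simp: PiE_iff)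

lemma lam_measurable: "(\<lambda>x. x) \<in> borel_measurable lam"
  by (rule measurable_ident_restrict[OF sets_lam])

lemma space_lam: "space lam = E"
  by (rule space_restrict_borel[OF sets_lam])

section \<open>Exhaustion of the gaps by finite sets\<close>

lemma countable_gaps: "countable (bounded_gaps E)"
  by (intro countable_bounded_gaps compact_imp_closed compact_E)

text \<open>An increasing exhaustion of the gaps by finite sets. It replaces the net of all finite
  subsets by a sequence, as needed for measurability of limits and for dominated
  convergence.\<close>

definition first_gaps :: "nat \<Rightarrow> real set set" where
  "first_gaps n = {U \<in> bounded_gaps E. to_nat_on (bounded_gaps E) U < n}"

lemma first_gaps_subset: "first_gaps n \<subseteq> bounded_gaps E" by (auto simp: first_gaps_def)

lemma finite_first_gaps: "finite (first_gaps n)"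
proof -
  have "inj_on (to_nat_on (bounded_gaps E)) (first_gaps n)"
    by (rule inj_on_subset[OF inj_on_to_nat_on[OF countable_gaps] first_gaps_subset])
  moreover have "to_nat_on (bounded_gaps E) ` first_gaps n \<subseteq> {..<n}" by (auto simp: first_gaps_def)
  ultimately show ?thesis by (meson finite_imageD finite_lessThan finite_subset)
qed

lemma eventually_first_gaps:
  assumes "finite F" "F \<subseteq> bounded_gaps E"
  shows "eventually (\<lambda>n. F \<subseteq> first_gaps n) sequentially"
proof -
  \<comment> \<open>The threshold exceeds every index occurring in \<open>F\<close>; the inserted
    \<open>0\<close> keeps the maximum meaningful for empty \<open>F\<close>.\<close>
  have "F \<subseteq> first_gaps n" if "Suc (Max (insert 0 (to_nat_on (bounded_gaps E) ` F))) \<le> n" for n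
  proof
    fix U assume "U \<in> F"
    then have "to_nat_on (bounded_gaps E) U \<le> Max (insert 0 (to_nat_on (bounded_gaps E) ` F))"
      using assms by (intro Max_ge) auto
    then have "to_nat_on (bounded_gaps E) U < n" using that by linarith
    then show "U \<in> first_gaps n" using \<open>U \<in> F\<close> assms by (auto simp: first_gaps_def)
  qed
  then show ?thesis unfolding eventually_sequentially by blast
qed

lemma filterlim_first_gaps: "filterlim first_gaps (finite_subsets_at_top (bounded_gaps E)) sequentially"
  unfolding filterlim_finite_subsets_at_top
proof (intro allI impI)
  fix X assume "finite X \<and> X \<subseteq> bounded_gaps E"
  then show "\<forall>\<^sub>F n in sequentially. finite (first_gaps n) \<and> X \<subseteq> first_gaps n \<and> first_gaps n \<subseteq> bounded_gaps E"
    using eventually_first_gaps[of X] finite_first_gaps first_gaps_subset by (auto elim: eventually_mono)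
qed

text \<open>Moving the condition on \<open>U\<close> from the index set into the summand makes the
  index set independent of \<open>x\<close>, so that one exhaustion serves all points.\<close>

lemma perturb_infsum:
  "perturb E \<omega> x = x + (\<Sum>\<^sub>\<infinity>U\<in>bounded_gaps E. if U \<subseteq> {..<x} then \<omega> U else 0)"
  unfolding perturb_def by (intro arg_cong2[of _ _ _ _ "(+)"] refl infsum_cong_neutral) auto

lemma summable_below:
  assumes "\<omega> \<in> space P"
  shows "(\<lambda>U. if U \<subseteq> {..<x} then \<omega> U else 0) summable_on bounded_gaps E"
  using \<delta>_summable by (rule summable_on_comparison_test) (use P_spaceD[OF assms] \<delta>_nonneg in auto)

definition perturb_partial :: "nat \<Rightarrow> (real set \<Rightarrow> real) \<Rightarrow> real \<Rightarrow> real" where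
  "perturb_partial n \<omega> x = x + (\<Sum>U\<in>first_gaps n. if U \<subseteq> {..<x} then \<omega> U else 0)"

lemma perturb_partial_tendsto:
  assumes "\<omega> \<in> space P"
  shows "(\<lambda>n. perturb_partial n \<omega> x) \<longlonglongrightarrow> perturb E \<omega> x"
proof -
  have "(sum (\<lambda>U. if U \<subseteq> {..<x} then \<omega> U else 0) \<longlongrightarrow>
      (\<Sum>\<^sub>\<infinity>U\<in>bounded_gaps E. if U \<subseteq> {..<x} then \<omega> U else 0)) (finite_subsets_at_top (bounded_gaps E))"
    using has_sum_infsum[OF summable_below[OF assms]] unfolding has_sum_def .
  from filterlim_compose[OF this filterlim_first_gaps] show ?thesis
    unfolding perturb_partial_def perturb_infsum by (intro tendsto_add tendsto_const) 
qed

lemma perturb_partial_measurable: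
  assumes "\<And>U. U \<in> bounded_gaps E \<Longrightarrow> (\<lambda>z. w z U) \<in> borel_measurable M"
    and [measurable]: "f \<in> borel_measurable M"
  shows "(\<lambda>z. perturb_partial n (w z) (f z)) \<in> borel_measurable M"
proof -
  have [measurable]: "(\<lambda>z. w z U) \<in> borel_measurable M" if "U \<in> first_gaps n" for U
    using assms(1) that first_gaps_subset by auto
  have "(\<lambda>z. if U \<subseteq> {..<f z} then w z U else 0) \<in> borel_measurable M" if "U \<in> first_gaps n" for U
    using that by measurable
  then show ?thesis unfolding perturb_partial_def by (intro borel_measurable_add borel_measurable_sum assms(2))
qed

text \<open>A pointwise limit of finite sums. Joint measurability in \<open>\<omega>\<close> and
  \<open>x\<close> is what the exchange of the two integrations in the moment estimate rests
  on.\<close>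

lemma perturb_measurable_pair: "(\<lambda>z. perturb E (fst z) (snd z)) \<in> borel_measurable (P \<Otimes>\<^sub>M lam)"
proof (rule borel_measurable_LIMSEQ_real)
  show "(\<lambda>n. perturb_partial n (fst z) (snd z)) \<longlonglongrightarrow> perturb E (fst z) (snd z)" if "z \<in> space (P \<Otimes>\<^sub>M lam)" for z
    using that by (intro perturb_partial_tendsto) (auto simp: space_pair_measure)
  show "(\<lambda>z. perturb_partial n (fst z) (snd z)) \<in> borel_measurable (P \<Otimes>\<^sub>M lam)" for n
  proof (rule perturb_partial_measurable)
    show "(\<lambda>z. fst z U) \<in> borel_measurable (P \<Otimes>\<^sub>M lam)" if "U \<in> bounded_gaps E" for U
      by (rule measurable_compose[OF measurable_fst P_component[OF that]])
    show "snd \<in> borel_measurable (P \<Otimes>\<^sub>M lam)"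
      by (rule measurable_compose[OF measurable_snd lam_measurable])
  qed
qed

lemma perturb_measurable:
  assumes "\<omega> \<in> space P"
  shows "perturb E \<omega> \<in> borel_measurable lam"
  using measurable_compose[OF measurable_Pair1'[OF assms, of lam] perturb_measurable_pair] by simp

text \<open>The shift of a point is at most the total sum of \<open>\<delta>\<close>, so one
  \<open>R\<close> serves all \<open>\<omega>\<close>. It yields the Lipschitz constant of the
  transform.\<close>

lemma perturb_bounded:
  "\<exists>R>0. \<forall>\<omega>\<in>space P. \<forall>x\<in>E. \<bar>perturb E \<omega> x\<bar> \<le> R"
proof -
  obtain B where B: "B > 0" "\<And>x. x \<in> E \<Longrightarrow> \<bar>x\<bar> \<le> B"
    using compact_imp_bounded[OF compact_E] unfolding bounded_pos by auto
  define S where "S = infsum \<delta> (bounded_gaps E)"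
  have "0 \<le> S" unfolding S_def by (intro infsum_nonneg \<delta>_nonneg)
  have "\<bar>perturb E \<omega> x\<bar> \<le> B + S" if "\<omega> \<in> space P" "x \<in> E" for \<omega> x
  proof -
    define T where "T = (\<Sum>\<^sub>\<infinity>U\<in>bounded_gaps E. if U \<subseteq> {..<x} then \<omega> U else 0)"
    have "0 \<le> T" unfolding T_def using P_spaceD[OF that(1)] by (intro infsum_nonneg) auto
    moreover have "T \<le> S" unfolding T_def S_def
      using P_spaceD[OF that(1)] \<delta>_nonneg by (intro infsum_mono summable_below that \<delta>_summable) auto
    ultimately show ?thesis unfolding perturb_infsum T_def[symmetric] using B(2)[OF that(2)] by linarith
  qed
  then show ?thesis using B \<open>0 \<le> S\<close> by (intro exI[of _ "B + S"]) auto
qed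

section \<open>Expectations of exponentials\<close>

lemma fourier_gap_dist:
  "(\<integral>w. cis (- (2 * pi * \<xi>) * w) \<partial>gap_dist \<delta> \<nu> U) = fourier_transform \<nu> (\<xi> * \<delta> U)"
proof -
  have "(\<lambda>w. cis (- (2 * pi * \<xi>) * w)) \<in> borel_measurable (restrict_space borel {0..\<delta> U})"
    by (intro measurable_restrict_space1) measurable
  then show ?thesis
    unfolding fourier_transform_cis gap_dist_def
    by (subst integral_distr[OF scale_measurable]) (auto simp: mult_ac)
qed

text \<open>Only the coordinates in \<open>J\<close> occur, so \<open>P\<close> may be replaced by
  its image on the finite product over \<open>J\<close>. There independence factors the
  integral.\<close>

lemma integral_prod_cis:
  assumes J: "finite J" "J \<subseteq> bounded_gaps E"
  shows "(\<integral>\<omega>. (\<Prod>U\<in>J. cis (- (2 * pi * \<xi> * n U) * \<omega> U)) \<partial>P)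
     = (\<Prod>U\<in>J. fourier_transform \<nu> (\<xi> * n U * \<delta> U))"
proof -
  interpret product_prob_space "gap_dist \<delta> \<nu>" "bounded_gaps E"
    by (intro product_prob_spaceI prob_gap_dist)
  define g where "g U w = cis (- (2 * pi * (\<xi> * n U)) * w)" for U w
  have g: "g U \<in> borel_measurable (gap_dist \<delta> \<nu> U)" for U
  proof -
    have "g U \<in> borel_measurable borel" unfolding g_def by measurable
    from measurable_compose[OF gap_dist_measurable[of U] this] show ?thesis .
  qed
  have gJ: "(\<lambda>\<omega>. g U (\<omega> U)) \<in> borel_measurable (Pi\<^sub>M J (gap_dist \<delta> \<nu>))" if "U \<in> J" for U
    by (rule measurable_compose[OF measurable_component_singleton[OF that, of "gap_dist \<delta> \<nu>"] g[of U]])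
  have "(\<integral>\<omega>. (\<Prod>U\<in>J. g U (\<omega> U)) \<partial>Pi\<^sub>M J (gap_dist \<delta> \<nu>))
    = (\<integral>\<omega>. (\<Prod>U\<in>J. g U (\<omega> U))
        \<partial>distr (Pi\<^sub>M (bounded_gaps E) (gap_dist \<delta> \<nu>)) (Pi\<^sub>M J (gap_dist \<delta> \<nu>)) (\<lambda>x. restrict x J))"
    by (simp only: distr_PiM_restrict_finite[OF J])
  also have "\<dots> = (\<integral>\<omega>. (\<Prod>U\<in>J. g U (restrict \<omega> J U)) \<partial>P)"
    unfolding P_eq
    by (intro integral_distr measurable_restrict_subset J(2) borel_measurable_prod gJ)
  finally have "(\<integral>\<omega>. (\<Prod>U\<in>J. g U (\<omega> U)) \<partial>P) = (\<integral>\<omega>. (\<Prod>U\<in>J. g U (\<omega> U)) \<partial>Pi\<^sub>M J (gap_dist \<delta> \<nu>))"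
    by simp
  also have "\<dots> = (\<Prod>U\<in>J. integral\<^sup>L (gap_dist \<delta> \<nu> U) (g U))"
  proof (rule product_integral_prod[OF J(1)])
    show "integrable (gap_dist \<delta> \<nu> U) (g U)" for U
      by (rule finite_measure.integrable_const_bound[of _ _ 1])
        (use g prob_gap_dist in \<open>auto simp: g_def prob_space_def\<close>)
  qed
  also have "\<dots> = (\<Prod>U\<in>J. fourier_transform \<nu> (\<xi> * n U * \<delta> U))"
    unfolding g_def fourier_gap_dist ..
  finally show ?thesis unfolding g_def by (simp add: mult.assoc)
qed

text \<open>In the exponent \<open>\<omega> U\<close> has an integer coefficient, which is odd, hence non-zero, when \<open>U\<close> lies
  below an odd number of the points.\<close>

proposition norm_expectation_le_parity_weight:
  fixes \<sigma> :: "nat \<Rightarrow> int" and \<xi> \<epsilon> :: real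
  assumes A: "finite A" "\<And>i. i \<in> A \<Longrightarrow> odd (\<sigma> i)"
    and F: "finite F" "F \<subseteq> bounded_gaps E"
    and \<epsilon>: "\<And>U k. U \<in> F \<Longrightarrow> odd k \<Longrightarrow> cmod (fourier_transform \<nu> (\<xi> * of_int k * \<delta> U)) \<le> \<epsilon>"
  shows "cmod (\<integral>\<omega>. cis (- (2 * pi * \<xi>) * (\<Sum>i\<in>A. of_int (\<sigma> i) * perturb E \<omega> (x i))) \<partial>P)
     \<le> parity_weight F \<epsilon> A x"
proof -
  interpret prob_space P by (rule prob_P)
  define n where "n U = (\<Sum>i\<in>{i\<in>A. U \<subseteq> {..<x i}}. \<sigma> i)" for U
  have odd_n: "odd (n U) \<longleftrightarrow> odd (card {i\<in>A. U \<subseteq> {..<x i}})" for U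
  proof -
    have "{i \<in> {i\<in>A. U \<subseteq> {..<x i}}. odd (\<sigma> i)} = {i\<in>A. U \<subseteq> {..<x i}}" using A(2) by auto
    then show ?thesis unfolding n_def using A(1) by (subst even_sum_iff) auto
  qed
  define c where "c = (\<Sum>i\<in>A. of_int (\<sigma> i) * x i)"
  define u where "u m \<omega> = cis (- (2 * pi * \<xi>) * (\<Sum>i\<in>A. of_int (\<sigma> i) * perturb_partial m \<omega> (x i)))" for m \<omega>
  have u_eq: "u m \<omega> = cis (- (2 * pi * \<xi>) * c) * (\<Prod>U\<in>first_gaps m. cis (- (2 * pi * \<xi> * of_int (n U)) * \<omega> U))" for m \<omega>
  proof -
    have "(\<Sum>i\<in>A. of_int (\<sigma> i) * perturb_partial m \<omega> (x i))
      = c + (\<Sum>i\<in>A. \<Sum>U\<in>first_gaps m. of_int (\<sigma> i) * (if U \<subseteq> {..<x i} then \<omega> U else 0))"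
      unfolding perturb_partial_def c_def by (simp add: distrib_left sum.distrib sum_distrib_left)
    also have "(\<Sum>i\<in>A. \<Sum>U\<in>first_gaps m. of_int (\<sigma> i) * (if U \<subseteq> {..<x i} then \<omega> U else 0))
      = (\<Sum>U\<in>first_gaps m. \<Sum>i\<in>A. if U \<subseteq> {..<x i} then of_int (\<sigma> i) * \<omega> U else 0)"
      by (subst sum.swap) (auto intro!: sum.cong)
    also have "\<dots> = (\<Sum>U\<in>first_gaps m. of_int (n U) * \<omega> U)"
      unfolding n_def using A(1) by (simp add: sum.inter_filter[symmetric] sum_distrib_right)
    finally have *: "- (2 * pi * \<xi>) * (\<Sum>i\<in>A. of_int (\<sigma> i) * perturb_partial m \<omega> (x i))
      = - (2 * pi * \<xi>) * c + (\<Sum>U\<in>first_gaps m. - (2 * pi * \<xi> * of_int (n U)) * \<omega> U)"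
      by (simp add: distrib_left sum_distrib_left mult_ac sum_negf)
    show ?thesis unfolding u_def * by (simp only: cis_mult[symmetric] cis_sum)
  qed
  \<comment> \<open>The product formula covers finitely many gaps only, so the full perturbation is
    reached by dominated convergence; the exponentials have modulus \<open>1\<close>.\<close>
  have lim: "(\<lambda>m. \<integral>\<omega>. u m \<omega> \<partial>P)
    \<longlonglongrightarrow> (\<integral>\<omega>. cis (- (2 * pi * \<xi>) * (\<Sum>i\<in>A. of_int (\<sigma> i) * perturb E \<omega> (x i))) \<partial>P)"
  proof (rule integral_dominated_convergence[where w = "\<lambda>_. 1"])
    have pn: "(\<lambda>\<omega>. perturb_partial m \<omega> (x i)) \<in> borel_measurable P" for m i
      by (rule perturb_partial_measurable[OF P_component]) auto
    then show "u m \<in> borel_measurable P" for m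
      unfolding u_def by measurable
    have "(\<lambda>\<omega>. perturb E \<omega> (x i)) \<in> borel_measurable P" for i
      by (rule borel_measurable_LIMSEQ_real[OF perturb_partial_tendsto pn])
    then show "(\<lambda>\<omega>. cis (- (2 * pi * \<xi>) * (\<Sum>i\<in>A. of_int (\<sigma> i) * perturb E \<omega> (x i)))) \<in> borel_measurable P"
      by measurable
    show "AE \<omega> in P. (\<lambda>m. u m \<omega>) \<longlonglongrightarrow> cis (- (2 * pi * \<xi>) * (\<Sum>i\<in>A. of_int (\<sigma> i) * perturb E \<omega> (x i)))"
    proof (rule AE_I2)
      fix \<omega> assume "\<omega> \<in> space P"
      then have "(\<lambda>m. - (2 * pi * \<xi>) * (\<Sum>i\<in>A. of_int (\<sigma> i) * perturb_partial m \<omega> (x i)))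
        \<longlonglongrightarrow> - (2 * pi * \<xi>) * (\<Sum>i\<in>A. of_int (\<sigma> i) * perturb E \<omega> (x i))"
        by (intro tendsto_intros perturb_partial_tendsto)
      then show "(\<lambda>m. u m \<omega>) \<longlonglongrightarrow> cis (- (2 * pi * \<xi>) * (\<Sum>i\<in>A. of_int (\<sigma> i) * perturb E \<omega> (x i)))"
        unfolding u_def
        by (rule continuous_on_tendsto_compose[of UNIV cis, rotated]) (auto intro: continuous_intros)
    qed
  qed (auto simp: u_def)
  have "eventually (\<lambda>m. cmod (\<integral>\<omega>. u m \<omega> \<partial>P) \<le> parity_weight F \<epsilon> A x) sequentially"
    using eventually_first_gaps[OF F]
  proof eventually_elim
    case (elim m)
    have "cmod (\<integral>\<omega>. u m \<omega> \<partial>P) = (\<Prod>U\<in>first_gaps m. cmod (fourier_transform \<nu> (\<xi> * of_int (n U) * \<delta> U)))"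
      unfolding u_eq integral_mult_right_zero integral_prod_cis[OF finite_first_gaps first_gaps_subset]
      by (simp add: norm_mult prod_norm)
    \<comment> \<open>Gaps outside \<open>F\<close>, and gaps with even coefficient, are estimated
      trivially by \<open>1\<close>. The bound is thus the same for every \<open>m\<close> with
      \<open>F \<subseteq> first_gaps m\<close>.\<close>
    also have "\<dots> \<le> (\<Prod>U\<in>first_gaps m. if U \<in> F \<and> odd (card {i\<in>A. U \<subseteq> {..<x i}}) then \<epsilon> else 1)"
      using \<epsilon> odd_n norm_fourier_transform_le_one[OF prob_\<nu>] by (intro prod_mono) auto
    also have "\<dots> = parity_weight F \<epsilon> A x"
      unfolding parity_weight_def
      by (rule prod.mono_neutral_cong_right) (use elim finite_first_gaps in auto)
    finally show ?case .
  qed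
  with tendsto_norm[OF lim] show ?thesis
    by (rule tendsto_upperbound) simp
qed

end

section \<open>Moments of the transform\<close>

text \<open>A chord of the unit circle is no longer than its arc.\<close>

lemma cmod_cis_diff_le: "cmod (cis x - cis y) \<le> \<bar>x - y\<bar>"
proof -
  have "cis x - cis y = cis y * (cis (x - y) - 1)"
    by (simp add: algebra_simps cis_mult)
  then have "cmod (cis x - cis y) = cmod (cis (x - y) - 1)" by (simp add: norm_mult)
  also have "\<dots> = 2 * \<bar>sin ((x - y) / 2)\<bar>"
    using dist_exp_i_1[of "x - y"] by (simp add: cis_conv_exp)
  also have "\<dots> \<le> \<bar>x - y\<bar>" using abs_sin_x_le_abs_x[of "(x - y) / 2"] by simp
  finally show ?thesis .
qed

text \<open>This turns an even power of a modulus into a product of integrals with alternating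
  conjugation, which can be merged into one integral over \<open>2 * q\<close> points.\<close>

lemma prod_alternating_cnj:
  "(\<Prod>i<2 * q. if even i then z else cnj z) = complex_of_real (cmod z ^ (2 * q))"
proof (induction q)
  case (Suc q)
  have "(\<Prod>i<2 * Suc q. if even i then z else cnj z)
    = (\<Prod>i<2 * q. if even i then z else cnj z) * (z * cnj z)" by (simp add: mult_ac)
  also have "\<dots> = complex_of_real (cmod z ^ (2 * q)) * complex_of_real ((cmod z)\<^sup>2)"
    unfolding Suc complex_norm_square ..
  also have "\<dots> = complex_of_real (cmod z ^ (2 * q) * (cmod z)\<^sup>2)" by (simp only: of_real_mult)
  also have "cmod z ^ (2 * q) * (cmod z)\<^sup>2 = cmod z ^ (2 * Suc q)"
    by (simp only: power_add[symmetric]) simp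
  finally show ?case .
qed simp

text \<open>If \<open>n\<close> elements have value at least \<open>c\<close>, the sum is at least
  \<open>n * c\<close>, which bounds \<open>n\<close>.\<close>

lemma finite_large_values:
  fixes f :: "'a \<Rightarrow> real"
  assumes f: "f summable_on A" "\<And>x. x \<in> A \<Longrightarrow> 0 \<le> f x" and c: "0 < c"
  shows "finite {x \<in> A. c \<le> f x}"
proof (rule ccontr)
  assume inf: "infinite {x \<in> A. c \<le> f x}"
  obtain n :: nat where n: "infsum f A / c < real n" using reals_Archimedean2 by blast
  obtain B where B: "finite B" "card B = n" "B \<subseteq> {x \<in> A. c \<le> f x}"
    using infinite_arbitrarily_large[OF inf] by blast
  have "real n * c \<le> sum f B" using sum_bounded_below[of B c f] B by auto
  also have "\<dots> \<le> infsum f A" using B f by (intro finite_sum_le_infsum) auto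
  finally show False using n c by (simp add: field_simps)
qed

context gap_perturbation
begin

text \<open>For \<open>\<omega>\<close> in the space of \<open>P\<close> this is the Fourier
  transform of the push-forward, written over the fixed measure \<open>lam\<close> so that it can be
  integrated in \<open>\<omega>\<close>.\<close>

definition transform :: "(real set \<Rightarrow> real) \<Rightarrow> real \<Rightarrow> complex" where
  "transform \<omega> \<xi> = (\<integral>x. cis (- (2 * pi * \<xi>) * perturb E \<omega> x) \<partial>lam)"

lemma fourier_transform_distr_perturb:
  assumes "\<omega> \<in> space P"
  shows "fourier_transform (distr lam borel (perturb E \<omega>)) \<xi> = transform \<omega> \<xi>"
  unfolding fourier_transform_cis transform_def
  by (subst integral_distr[OF perturb_measurable[OF assms]]) auto

lemma norm_transform_le_one: "cmod (transform \<omega> \<xi>) \<le> 1"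
proof -
  interpret prob_space lam by (rule prob_lam)
  have "cmod (transform \<omega> \<xi>) \<le> (\<integral>x. norm (cis (- (2 * pi * \<xi>) * perturb E \<omega> x)) \<partial>lam)"
    unfolding transform_def by (rule integral_norm_bound)
  then show ?thesis by (simp add: prob_space)
qed

lemma transform_uminus: "transform \<omega> (- \<xi>) = cnj (transform \<omega> \<xi>)"
proof -
  have "transform \<omega> (- \<xi>) = (\<integral>x. cnj (cis (- (2 * pi * \<xi>) * perturb E \<omega> x)) \<partial>lam)"
    unfolding transform_def by (simp add: cis_cnj)
  then show ?thesis by (simp add: transform_def)
qed

lemma transform_lipschitz:
  assumes \<omega>: "\<omega> \<in> space P" and R: "\<And>x. x \<in> E \<Longrightarrow> \<bar>perturb E \<omega> x\<bar> \<le> R"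
  shows "cmod (transform \<omega> \<xi> - transform \<omega> \<eta>) \<le> 2 * pi * R * \<bar>\<xi> - \<eta>\<bar>"
proof -
  interpret prob_space lam by (rule prob_lam)
  have int: "integrable lam (\<lambda>x. cis (- (2 * pi * \<xi>) * perturb E \<omega> x))" for \<xi>
    by (intro integrable_cis borel_measurable_times perturb_measurable[OF \<omega>] borel_measurable_const)
  have "transform \<omega> \<xi> - transform \<omega> \<eta>
     = (\<integral>x. cis (- (2 * pi * \<xi>) * perturb E \<omega> x) - cis (- (2 * pi * \<eta>) * perturb E \<omega> x) \<partial>lam)"
    unfolding transform_def by (rule Bochner_Integration.integral_diff[symmetric, OF int int])
  also have "cmod \<dots> \<le> (\<integral>x. 2 * pi * R * \<bar>\<xi> - \<eta>\<bar> \<partial>lam)"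
  proof (rule Bochner_Integration.integral_norm_bound_integral)
    fix x assume "x \<in> space lam"
    then have x: "\<bar>perturb E \<omega> x\<bar> \<le> R" using R space_lam by simp
    have "cmod (cis (- (2 * pi * \<xi>) * perturb E \<omega> x) - cis (- (2 * pi * \<eta>) * perturb E \<omega> x))
      \<le> \<bar>(- (2 * pi * \<xi>) * perturb E \<omega> x) - (- (2 * pi * \<eta>) * perturb E \<omega> x)\<bar>"
      by (rule cmod_cis_diff_le)
    also have "(- (2 * pi * \<xi>) * perturb E \<omega> x) - (- (2 * pi * \<eta>) * perturb E \<omega> x)
      = - (2 * pi * perturb E \<omega> x * (\<xi> - \<eta>))" by (simp add: algebra_simps)
    also have "\<bar>\<dots>\<bar> = 2 * pi * \<bar>perturb E \<omega> x\<bar> * \<bar>\<xi> - \<eta>\<bar>" by (simp add: abs_mult)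
    also have "\<dots> \<le> 2 * pi * R * \<bar>\<xi> - \<eta>\<bar>" using x by (intro mult_right_mono mult_left_mono) auto
    finally show "cmod (cis (- (2 * pi * \<xi>) * perturb E \<omega> x) - cis (- (2 * pi * \<eta>) * perturb E \<omega> x))
      \<le> 2 * pi * R * \<bar>\<xi> - \<eta>\<bar>" .
  qed (use int in auto)
  also have "\<dots> = 2 * pi * R * \<bar>\<xi> - \<eta>\<bar>" by (simp add: prob_space)
  finally show ?thesis .
qed

lemma transform_measurable: "(\<lambda>\<omega>. transform \<omega> \<xi>) \<in> borel_measurable P"
proof -
  interpret prob_space lam by (rule prob_lam)
  note perturb_measurable_pair[measurable]
  have "(\<lambda>z. cis (- (2 * pi * \<xi>) * perturb E (fst z) (snd z))) \<in> borel_measurable (P \<Otimes>\<^sub>M lam)"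
    by measurable
  then have "case_prod (\<lambda>\<omega> x. cis (- (2 * pi * \<xi>) * perturb E \<omega> x)) \<in> borel_measurable (P \<Otimes>\<^sub>M lam)"
    by (simp add: case_prod_beta')
  then show ?thesis unfolding transform_def by (rule borel_measurable_lebesgue_integral)
qed

lemma norm_transform_measurable: "(\<lambda>\<omega>. cmod (transform \<omega> \<xi>)) \<in> borel_measurable P"
  by (rule measurable_compose[OF transform_measurable borel_measurable_norm])

text \<open>The moment is an integral over \<open>\<omega>\<close> and over \<open>2 * q\<close>
  points of \<open>E\<close>. Exchanging the order, the expectation at fixed points is at most their
  \<open>parity_weight\<close>, whose integral is already bounded.\<close>

proposition transform_moment_le:
  assumes F: "finite F" "F \<subseteq> bounded_gaps E" and \<epsilon>: "0 \<le> \<epsilon>" "\<epsilon> \<le> 1"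
    and decay: "\<And>U k. U \<in> F \<Longrightarrow> odd k \<Longrightarrow> cmod (fourier_transform \<nu> (\<xi> * of_int k * \<delta> U)) \<le> \<epsilon>"
    and K: "\<And>x. x \<in> space lam \<Longrightarrow>
      (\<integral>\<^sup>+y. (if x \<le> y then ennreal (crossing_weight F \<epsilon> x y) else 0) \<partial>lam) \<le> K"
  shows "(\<integral>\<^sup>+\<omega>. ennreal (cmod (transform \<omega> \<xi>) ^ (2 * q)) \<partial>P) \<le> (of_nat ((2 * q)\<^sup>2) * K) ^ q"
proof -
  define A where "A = {..<2 * q}"
  define L where "L = Pi\<^sub>M A (\<lambda>_. lam)"
  \<comment> \<open>The sign is negative at the indices where the transform is conjugated. All that
    matters for the bound on the expectation is that each value is odd.\<close>
  define \<sigma> :: "nat \<Rightarrow> int" where "\<sigma> i = (-1) ^ i" for i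
  define \<Phi> where "\<Phi> \<omega> x = cis (- (2 * pi * \<xi>) * (\<Sum>i\<in>A. of_int (\<sigma> i) * perturb E \<omega> (x i)))" for \<omega> x
  interpret P: prob_space P by (rule prob_P)
  interpret lam: prob_space lam by (rule prob_lam)
  interpret Q: product_prob_space "\<lambda>_::nat. lam" A by standard
  interpret L: prob_space L unfolding L_def by (intro prob_space_PiM prob_lam)
  interpret PL: pair_prob_space P L ..
  have comp: "(\<lambda>x. x i) \<in> measurable L lam" if "i \<in> A" for i
    unfolding L_def using measurable_component_singleton[OF that, of "\<lambda>_. lam"] .
  have pair: "(\<lambda>z. perturb E (fst z) (snd z i)) \<in> borel_measurable (P \<Otimes>\<^sub>M L)" if "i \<in> A" for i
  proof -
    have "(\<lambda>z. (fst z, snd z i)) \<in> measurable (P \<Otimes>\<^sub>M L) (P \<Otimes>\<^sub>M lam)"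
      by (intro measurable_Pair measurable_fst measurable_compose[OF measurable_snd comp[OF that]])
    from measurable_compose[OF this perturb_measurable_pair] show ?thesis by simp
  qed
  have "(\<lambda>z. \<Phi> (fst z) (snd z)) \<in> borel_measurable (P \<Otimes>\<^sub>M L)"
    unfolding \<Phi>_def
    by (intro measurable_compose[OF _ borel_measurable_cis] borel_measurable_times borel_measurable_sum
        borel_measurable_const pair)
  then have int: "integrable (P \<Otimes>\<^sub>M L) (case_prod \<Phi>)"
    by (intro PL.integrable_const_bound[of _ 1]) (auto simp: case_prod_beta' \<Phi>_def)
  have power: "complex_of_real (cmod (transform \<omega> \<xi>) ^ (2 * q)) = (\<integral>x. \<Phi> \<omega> x \<partial>L)" if \<omega>: "\<omega> \<in> space P" for \<omega>
  proof -
    have "complex_of_real (cmod (transform \<omega> \<xi>) ^ (2 * q))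
      = (\<Prod>i\<in>A. if even i then transform \<omega> \<xi> else cnj (transform \<omega> \<xi>))"
      unfolding A_def prod_alternating_cnj ..
    also have "\<dots> = (\<Prod>i\<in>A. \<integral>x. cis (- (2 * pi * \<xi>) * (of_int (\<sigma> i) * perturb E \<omega> x)) \<partial>lam)"
    proof (intro prod.cong refl)
      fix i
      show "(if even i then transform \<omega> \<xi> else cnj (transform \<omega> \<xi>))
        = (\<integral>x. cis (- (2 * pi * \<xi>) * (of_int (\<sigma> i) * perturb E \<omega> x)) \<partial>lam)"
        by (cases "even i") (simp_all only: transform_uminus[symmetric], simp_all add: transform_def \<sigma>_def)
    qed
    also have "\<dots> = (\<integral>x. (\<Prod>i\<in>A. cis (- (2 * pi * \<xi>) * (of_int (\<sigma> i) * perturb E \<omega> (x i)))) \<partial>L)"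
      unfolding L_def
      by (intro Q.product_integral_prod[symmetric] lam.integrable_cis borel_measurable_times
          perturb_measurable[OF \<omega>] borel_measurable_const) (simp add: A_def)
    also have "\<dots> = (\<integral>x. \<Phi> \<omega> x \<partial>L)"
      unfolding \<Phi>_def sum_distrib_left cis_sum ..
    finally show ?thesis .
  qed
  have weight_int: "integrable L (parity_weight F \<epsilon> A)"
  proof -
    have "parity_weight F \<epsilon> A \<in> borel_measurable L"
      by (intro measurable_parity_weight measurable_compose[OF comp lam_measurable])
    then show ?thesis
      using \<epsilon> parity_weight_nonneg[OF \<epsilon>(1)] parity_weight_le_one[OF \<epsilon>]
      by (intro L.integrable_const_bound[of _ 1]) auto
  qed
  have meas: "(\<lambda>\<omega>. cmod (transform \<omega> \<xi>) ^ (2 * q)) \<in> borel_measurable P"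
    by (intro borel_measurable_power norm_transform_measurable) 
  have "integrable P (\<lambda>\<omega>. cmod (transform \<omega> \<xi>) ^ (2 * q))"
    by (intro P.integrable_const_bound[of _ 1] meas) (auto simp: norm_transform_le_one power_le_one)
  then have "(\<integral>\<^sup>+\<omega>. ennreal (cmod (transform \<omega> \<xi>) ^ (2 * q)) \<partial>P)
    = ennreal (\<integral>\<omega>. cmod (transform \<omega> \<xi>) ^ (2 * q) \<partial>P)"
    by (intro nn_integral_eq_integral) auto
  also have "(\<integral>\<omega>. cmod (transform \<omega> \<xi>) ^ (2 * q) \<partial>P) \<le> (\<integral>x. parity_weight F \<epsilon> A x \<partial>L)"
  proof -
    \<comment> \<open>The real moment is read as a complex number, so that the integrals can be
      exchanged before moduli are taken.\<close>
    have "(\<integral>\<omega>. cmod (transform \<omega> \<xi>) ^ (2 * q) \<partial>P)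
      \<le> cmod (complex_of_real (\<integral>\<omega>. cmod (transform \<omega> \<xi>) ^ (2 * q) \<partial>P))" by simp
    also have "complex_of_real (\<integral>\<omega>. cmod (transform \<omega> \<xi>) ^ (2 * q) \<partial>P)
      = (\<integral>\<omega>. complex_of_real (cmod (transform \<omega> \<xi>) ^ (2 * q)) \<partial>P)" by (rule integral_complex_of_real[symmetric])
    also have "\<dots> = (\<integral>\<omega>. (\<integral>x. \<Phi> \<omega> x \<partial>L) \<partial>P)"
      by (intro Bochner_Integration.integral_cong refl power)
    also have "\<dots> = (\<integral>x. (\<integral>\<omega>. \<Phi> \<omega> x \<partial>P) \<partial>L)"
      by (rule PL.Fubini_integral[OF int, symmetric])
    also have "cmod \<dots> \<le> (\<integral>x. parity_weight F \<epsilon> A x \<partial>L)"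
    proof (rule order_trans[OF integral_norm_bound integral_mono])
      show "integrable L (\<lambda>x. cmod (\<integral>\<omega>. \<Phi> \<omega> x \<partial>P))"
        by (intro integrable_norm PL.integrable_snd[OF int])
      show "integrable L (parity_weight F \<epsilon> A)" by (rule weight_int)
      show "cmod (\<integral>\<omega>. \<Phi> \<omega> x \<partial>P) \<le> parity_weight F \<epsilon> A x" for x
        unfolding \<Phi>_def by (rule norm_expectation_le_parity_weight[OF _ _ F decay]) (auto simp: A_def \<sigma>_def)
    qed
    finally show ?thesis .
  qed
  also have "ennreal (\<integral>x. parity_weight F \<epsilon> A x \<partial>L) = (\<integral>\<^sup>+x. ennreal (parity_weight F \<epsilon> A x) \<partial>L)"
    by (rule nn_integral_eq_integral[OF weight_int, symmetric]) (simp add: parity_weight_nonneg \<epsilon>)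
  also have "\<dots> \<le> (of_nat ((2 * q)\<^sup>2) * K) ^ q"
    unfolding L_def by (rule nn_integral_parity_weight_le[OF prob_lam lam_measurable \<epsilon> K]) (auto simp: A_def)
  finally show ?thesis by (simp add: ennreal_leI)
qed

end

section \<open>Decay along square roots of integers\<close>

context gap_perturbation
begin

lemma finite_large_gaps:
  assumes "0 < X"
  shows "finite {U \<in> bounded_gaps E. inverse X \<le> \<delta> U}"
  by (rule finite_large_values[OF \<delta>_summable \<delta>_nonneg]) (use assms in simp)

text \<open>Here \<open>\<epsilon>\<close> is fixed by \<open>b\<close>, and the decay of the
  transform of \<open>\<nu>\<close> provides the frequency \<open>C\<close> beyond which it is at
  most \<open>\<epsilon>\<close>. The threshold \<open>\<xi>0 = C * x0\<close> is the same for all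
  \<open>q\<close>; only the constant depends on \<open>q\<close>.\<close>

proposition transform_moment_decay:
  assumes decay: "(fourier_transform \<nu> \<longlongrightarrow> 0) at_infinity"
    and b: "0 < b" and x0: "0 < x0"
    and gaps: "\<And>J x. is_interval J \<Longrightarrow> x0 \<le> x \<Longrightarrow> 0 < measure lam (J \<inter> E) \<Longrightarrow>
           a + b * (ln (measure lam (J \<inter> E)) + s * ln x) \<le> real (gap_count E \<delta> J x)"
  obtains \<xi>0 where "0 < \<xi>0" and "\<And>q. \<exists>C\<ge>0. \<forall>\<xi>\<ge>\<xi>0.
    (\<integral>\<^sup>+\<omega>. ennreal (cmod (transform \<omega> \<xi>) ^ (2 * q)) \<partial>P) \<le> ennreal (C * \<xi> powr (- s * real q))"
proof -
  define \<epsilon> where "\<epsilon> = exp (- 1 / b) / 2"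
  have \<epsilon>: "0 < \<epsilon>" "\<epsilon> \<le> 1"
    unfolding \<epsilon>_def using half_exp_le_one[OF b] by simp_all
  obtain B where B: "\<And>\<eta>. B \<le> \<bar>\<eta>\<bar> \<Longrightarrow> cmod (fourier_transform \<nu> \<eta>) < \<epsilon>"
    using tendstoD[OF decay \<epsilon>(1)] unfolding eventually_at_infinity by (auto simp: dist_norm)
  define C where "C = max 1 B"
  have C: "0 < C" "\<And>\<eta>. C \<le> \<bar>\<eta>\<bar> \<Longrightarrow> cmod (fourier_transform \<nu> \<eta>) \<le> \<epsilon>"
    using B by (auto simp: C_def intro: less_imp_le)
  \<comment> \<open>The factor \<open>C powr s\<close> comes from writing
    \<open>X powr (- s)\<close> with \<open>X = \<xi> / C\<close> in terms of
    \<open>\<xi>\<close>.\<close>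
  define K0 where "K0 = 2 * exp (- a / b) * C powr s"
  have K0: "0 \<le> K0" by (simp add: K0_def)
  have main: "(\<integral>\<^sup>+\<omega>. ennreal (cmod (transform \<omega> \<xi>) ^ (2 * q)) \<partial>P)
     \<le> ennreal ((real ((2 * q)\<^sup>2) * K0) ^ q * \<xi> powr (- s * real q))" if \<xi>: "C * x0 \<le> \<xi>" for \<xi> q
  proof -
    \<comment> \<open>With this scale, \<open>inverse X \<le> \<delta> U\<close> says
      \<open>C \<le> \<xi> * \<delta> U\<close>, so every odd multiple of
      \<open>\<xi> * \<delta> U\<close> lies in the range where the transform of
      \<open>\<nu>\<close> is small.\<close>
    define X where "X = \<xi> / C"
    have "0 < C * x0" using C x0 by simp
    then have "0 < \<xi>" using \<xi> by linarith
    have X: "x0 \<le> X" "0 < X" using \<xi> C x0 \<open>0 < \<xi>\<close> by (auto simp: X_def field_simps)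
    define F where "F = {U \<in> bounded_gaps E. inverse X \<le> \<delta> U}"
    have F: "finite F" "F \<subseteq> bounded_gaps E" unfolding F_def using finite_large_gaps X by auto
    have "(\<integral>\<^sup>+\<omega>. ennreal (cmod (transform \<omega> \<xi>) ^ (2 * q)) \<partial>P)
      \<le> (of_nat ((2 * q)\<^sup>2) * ennreal (2 * exp (- a / b) * X powr (- s))) ^ q"
    proof (rule transform_moment_le[OF F less_imp_le[OF \<epsilon>(1)] \<epsilon>(2)])
      show "cmod (fourier_transform \<nu> (\<xi> * of_int k * \<delta> U)) \<le> \<epsilon>" if "U \<in> F" "odd k" for U k
      proof (rule C(2))
        have "1 \<le> \<bar>real_of_int k\<bar>" using \<open>odd k\<close> by (cases "k = 0") auto
        moreover have "C \<le> \<xi> * \<delta> U" using that \<open>0 < \<xi>\<close> C by (auto simp: F_def X_def field_simps)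
        ultimately have "C * 1 \<le> (\<xi> * \<delta> U) * \<bar>real_of_int k\<bar>"
          using C \<open>0 < \<xi>\<close> \<delta>_nonneg[of U] by (intro mult_mono) auto
        then show "C \<le> \<bar>\<xi> * real_of_int k * \<delta> U\<bar>"
          using \<open>0 < \<xi>\<close> \<delta>_nonneg[of U] by (simp add: abs_mult mult_ac)
      qed
      show "(\<integral>\<^sup>+y. (if x \<le> y then ennreal (crossing_weight F \<epsilon> x y) else 0) \<partial>lam)
        \<le> ennreal (2 * exp (- a / b) * X powr (- s))" for x
        by (rule nn_integral_crossing_weight_le[OF prob_lam sets_lam compact_imp_bounded[OF compact_E]
            b X(2) F(1) F_def \<epsilon>_def gaps]) (use X in auto)
    qed
    also have "2 * exp (- a / b) * X powr (- s) = K0 * \<xi> powr (- s)"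
      using C \<open>0 < \<xi>\<close> by (simp add: K0_def X_def powr_divide powr_minus field_simps)
    also have "(of_nat ((2 * q)\<^sup>2) * ennreal (K0 * \<xi> powr (- s))) ^ q
      = ennreal ((real ((2 * q)\<^sup>2) * K0) ^ q * \<xi> powr (- s * real q))"
    proof -
      have "(\<xi> powr (- s)) ^ q = \<xi> powr (- s * real q)"
        using \<open>0 < \<xi>\<close> by (simp add: powr_realpow[symmetric] powr_powr)
      then have "(real ((2 * q)\<^sup>2) * (K0 * \<xi> powr (- s))) ^ q = (real ((2 * q)\<^sup>2) * K0) ^ q * \<xi> powr (- s * real q)"
        by (simp only: power_mult_distrib mult.assoc)
      moreover have "(of_nat ((2 * q)\<^sup>2) * ennreal (K0 * \<xi> powr (- s))) ^ q
        = ennreal ((real ((2 * q)\<^sup>2) * (K0 * \<xi> powr (- s))) ^ q)"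
        using K0 by (simp only: ennreal_of_nat_eq_real_of_nat) (simp add: ennreal_mult[symmetric] ennreal_power)
      ultimately show ?thesis by simp
    qed
    finally show ?thesis .
  qed
  show ?thesis
  proof (rule that[of "C * x0"])
    show "0 < C * x0" using C x0 by simp
    show "\<exists>C'\<ge>0. \<forall>\<xi>\<ge>C * x0. (\<integral>\<^sup>+\<omega>. ennreal (cmod (transform \<omega> \<xi>) ^ (2 * q)) \<partial>P)
        \<le> ennreal (C' * \<xi> powr (- s * real q))" for q
      using main K0 by (intro exI[of _ "(real ((2 * q)\<^sup>2) * K0) ^ q"]) auto
  qed
qed

text \<open>The points \<open>sqrt n\<close> have spacing of order \<open>1 / sqrt n\<close>, so that the Lipschitz bound on the
  transform bridges the gaps between them without losing decay of order at most \<open>1 / 2\<close>.\<close>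

lemma bounded_transform_of_sqrt:
  assumes \<omega>: "\<omega> \<in> space P" and t: "0 \<le> t" "t \<le> 1"
    and B: "\<And>n. N \<le> n \<Longrightarrow> cmod (transform \<omega> (sqrt (real n))) * sqrt (real n) powr (t / 2) \<le> B"
    and N: "1 \<le> N"
  shows "bounded (range (\<lambda>\<xi>. cmod (transform \<omega> \<xi>) * \<bar>\<xi>\<bar> powr (t / 2)))"
proof -
  obtain R where R: "0 < R" "\<And>x. x \<in> E \<Longrightarrow> \<bar>perturb E \<omega> x\<bar> \<le> R"
    using perturb_bounded \<omega> by blast
  have "0 \<le> cmod (transform \<omega> (sqrt (real N))) * sqrt (real N) powr (t / 2)" by simp
  then have B0: "0 \<le> B" using B[of N] by linarith
  have large: "cmod (transform \<omega> r) * r powr (t / 2) \<le> 2 * B + 2 * pi * R" if r: "real N \<le> r\<^sup>2" "0 < r" for r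
  proof -
    \<comment> \<open>\<open>sqrt n\<close> is the last sample point not exceeding
      \<open>r\<close>.\<close>
    define n where "n = nat \<lfloor>r\<^sup>2\<rfloor>"
    have n: "real n \<le> r\<^sup>2" "r\<^sup>2 < real n + 1" by (auto simp: n_def)
    have "N \<le> n" using r(1) unfolding n_def by linarith
    then have n1: "1 \<le> real n" using N by simp
    have "1 \<le> r\<^sup>2" using n n1 by linarith
    then have r1: "1 \<le> r" using r(2) by (simp add: power2_le_imp_le[of 1 r])
    define m where "m = sqrt (real n)"
    have m: "1 \<le> m" "m\<^sup>2 = real n" using n1 by (auto simp: m_def)
    have "m \<le> r" by (rule power2_le_imp_le) (use n(1) m r(2) in simp_all)
    \<comment> \<open>Bounding by the difference of squares, which is at most \<open>1\<close>,
      shows that the distance to the sample point is at most \<open>1 / r\<close>.\<close>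
    have "(r - m) * r \<le> (r - m) * (r + m)" using \<open>m \<le> r\<close> m by (intro mult_left_mono) auto
    also have "\<dots> = r\<^sup>2 - m\<^sup>2" by (simp add: power2_eq_square algebra_simps)
    also have "\<dots> \<le> 1" using n m by simp
    finally have gap: "\<bar>r - m\<bar> * r \<le> 1" using \<open>m \<le> r\<close> by simp
    have "r\<^sup>2 \<le> (2 * m)\<^sup>2" using n m n1 by (simp add: power_mult_distrib)
    then have "r \<le> 2 * m" by (rule power2_le_imp_le) (use m in simp)
    then have "r powr (t / 2) \<le> (2 * m) powr (t / 2)" using r t by (intro powr_mono2) auto
    also have "\<dots> = 2 powr (t / 2) * m powr (t / 2)" using m by (simp add: powr_mult)
    also have "\<dots> \<le> 2 * m powr (t / 2)"
      using powr_mono[of "t / 2" 1 "2::real"] t by (intro mult_right_mono) auto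
    finally have rm: "r powr (t / 2) \<le> 2 * m powr (t / 2)" .
    have rr: "r powr (t / 2) \<le> r" using powr_mono[of "t / 2" 1 r] t r1 by simp
    have "cmod (transform \<omega> r) \<le> cmod (transform \<omega> m) + cmod (transform \<omega> r - transform \<omega> m)"
      using norm_triangle_ineq[of "transform \<omega> m" "transform \<omega> r - transform \<omega> m"] by simp
    also have "\<dots> \<le> cmod (transform \<omega> m) + 2 * pi * R * \<bar>r - m\<bar>"
      using transform_lipschitz[OF \<omega> R(2), of r m] by simp
    finally have "cmod (transform \<omega> r) * r powr (t / 2)
      \<le> (cmod (transform \<omega> m) + 2 * pi * R * \<bar>r - m\<bar>) * r powr (t / 2)"
      by (rule mult_right_mono) simp
    also have "\<dots> = cmod (transform \<omega> m) * r powr (t / 2) + 2 * pi * R * (\<bar>r - m\<bar> * r powr (t / 2))"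
      by (simp add: algebra_simps)
    also have "\<dots> \<le> cmod (transform \<omega> m) * (2 * m powr (t / 2)) + 2 * pi * R * (\<bar>r - m\<bar> * r)"
      using rm rr R by (intro add_mono mult_left_mono) auto
    also have "\<dots> \<le> 2 * B + 2 * pi * R * 1"
      using B[OF \<open>N \<le> n\<close>] gap R by (intro add_mono mult_left_mono) (auto simp: m_def)
    finally show ?thesis by simp
  qed
  have "cmod (transform \<omega> \<xi>) * \<bar>\<xi>\<bar> powr (t / 2) \<le> 2 * B + 2 * pi * R + real N" for \<xi>
  proof (cases "real N \<le> \<bar>\<xi>\<bar>\<^sup>2 \<and> 0 < \<bar>\<xi>\<bar>")
    case True
    have "cmod (transform \<omega> \<bar>\<xi>\<bar>) = cmod (transform \<omega> \<xi>)"
      by (cases "0 \<le> \<xi>") (auto simp: transform_uminus)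
    then show ?thesis using large[of "\<bar>\<xi>\<bar>"] True by simp
  next
    case False
    have "\<bar>\<xi>\<bar> \<le> real N"
    proof (rule power2_le_imp_le)
      have "\<bar>\<xi>\<bar>\<^sup>2 \<le> real N" using False by (cases "\<xi> = 0") auto
      also have "\<dots> \<le> (real N)\<^sup>2" using N by (simp add: power2_eq_square)
      finally show "\<bar>\<xi>\<bar>\<^sup>2 \<le> (real N)\<^sup>2" .
    qed simp
    then have "\<bar>\<xi>\<bar> powr (t / 2) \<le> real N powr (t / 2)" using t by (intro powr_mono2) auto
    also have "\<dots> \<le> real N" using powr_mono[of "t / 2" 1 "real N"] t N by simp
    finally have "cmod (transform \<omega> \<xi>) * \<bar>\<xi>\<bar> powr (t / 2) \<le> 1 * real N"
      by (intro mult_mono norm_transform_le_one) auto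
    moreover have "0 \<le> 2 * B + 2 * pi * R" using B0 R by simp
    ultimately show ?thesis by linarith
  qed
  then show ?thesis unfolding bounded_iff by (intro exI[of _ "2 * B + 2 * pi * R + real N"]) auto
qed

text \<open>Finiteness of the sum of the moments makes the sum of the powers
  \<open>Y n \<omega> ^ (2 * q)\<close> finite almost surely, so \<open>Y n \<omega>\<close> is
  bounded in \<open>n\<close>.\<close>

proposition AE_transform_decay:
  assumes \<xi>0: "0 < \<xi>0" and moments: "\<And>q. \<exists>C\<ge>0. \<forall>\<xi>\<ge>\<xi>0.
    (\<integral>\<^sup>+\<omega>. ennreal (cmod (transform \<omega> \<xi>) ^ (2 * q)) \<partial>P) \<le> ennreal (C * \<xi> powr (- s * real q))"
    and t: "0 \<le> t" "t < s" "s \<le> 1"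
  shows "AE \<omega> in P. bounded (range (\<lambda>\<xi>. cmod (transform \<omega> \<xi>) * \<bar>\<xi>\<bar> powr (t / 2)))"
proof -
  obtain q :: nat where q: "4 / (s - t) < real q" using reals_Archimedean2 by blast
  \<comment> \<open>At \<open>\<xi> = sqrt n\<close> the exponent \<open>4\<close> becomes
    \<open>n powr (- 2)\<close>, which is summable.\<close>
  have qst: "4 \<le> (s - t) * real q" using q t by (simp add: field_simps)
  have q0: "0 < q" using qst by (cases q) auto
  obtain C where C: "0 \<le> C" "\<And>\<xi>. \<xi>0 \<le> \<xi> \<Longrightarrow>
    (\<integral>\<^sup>+\<omega>. ennreal (cmod (transform \<omega> \<xi>) ^ (2 * q)) \<partial>P) \<le> ennreal (C * \<xi> powr (- s * real q))"
    using moments[of q] by blast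
  define N where "N = Suc (nat \<lceil>\<xi>0\<^sup>2\<rceil>)"
  have N: "1 \<le> N" "\<xi>0\<^sup>2 \<le> real N" unfolding N_def by (auto, linarith)
  define Y where "Y n \<omega> = cmod (transform \<omega> (sqrt (real n))) * sqrt (real n) powr (t / 2)" for n \<omega>
  have Y_meas: "(\<lambda>\<omega>. ennreal (Y n \<omega> ^ (2 * q))) \<in> borel_measurable P" for n
    unfolding Y_def
    by (intro measurable_compose[OF _ measurable_ennreal] borel_measurable_power borel_measurable_times
        norm_transform_measurable borel_measurable_const)
  have Y_moment: "(\<integral>\<^sup>+\<omega>. ennreal (Y n \<omega> ^ (2 * q)) \<partial>P) \<le> ennreal (C * real n powr (- 2))" if "N \<le> n" for n
  proof -
    define m where "m = sqrt (real n)"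
    have n1: "1 \<le> real n" using that N by simp
    have m: "1 \<le> m" "\<xi>0 \<le> m" using n1 that N \<xi>0 by (auto simp: m_def intro!: real_le_rsqrt)
    have "(m powr (t / 2)) ^ (2 * q) = m powr (t * real q)"
      using m by (simp add: powr_realpow[symmetric] powr_powr)
    then have "(\<integral>\<^sup>+\<omega>. ennreal (Y n \<omega> ^ (2 * q)) \<partial>P)
      = (\<integral>\<^sup>+\<omega>. ennreal (m powr (t * real q)) * ennreal (cmod (transform \<omega> m) ^ (2 * q)) \<partial>P)"
      by (simp add: Y_def m_def[symmetric] power_mult_distrib ennreal_mult mult_ac)
    also have "\<dots> = ennreal (m powr (t * real q)) * (\<integral>\<^sup>+\<omega>. ennreal (cmod (transform \<omega> m) ^ (2 * q)) \<partial>P)"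
      by (intro nn_integral_cmult measurable_compose[OF _ measurable_ennreal] borel_measurable_power
        norm_transform_measurable)
    also have "\<dots> \<le> ennreal (m powr (t * real q)) * ennreal (C * m powr (- s * real q))"
      by (intro mult_left_mono C m) auto
    also have "\<dots> = ennreal (C * m powr (- ((s - t) * real q)))"
      using C(1) by (simp add: ennreal_mult[symmetric] powr_add[symmetric] algebra_simps)
    also have "\<dots> \<le> ennreal (C * m powr (- 4))"
      using C(1) m qst by (intro ennreal_leI mult_left_mono powr_mono) auto
    also have "m powr (- 4) = real n powr (- 2)"
      using n1 by (simp add: m_def powr_half_sqrt[symmetric] powr_powr)
    finally show ?thesis .
  qed
  have "(\<integral>\<^sup>+\<omega>. (\<Sum>n. ennreal (Y (n + N) \<omega> ^ (2 * q))) \<partial>P) = (\<Sum>n. \<integral>\<^sup>+\<omega>. ennreal (Y (n + N) \<omega> ^ (2 * q)) \<partial>P)"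
    by (intro nn_integral_suminf Y_meas)
  also have "\<dots> \<le> (\<Sum>n. ennreal (C * real (n + N) powr (- 2)))"
    by (intro suminf_le Y_moment summableI) auto
  also have "\<dots> < \<infinity>"
  proof -
    have "summable (\<lambda>n. C * real (n + N) powr (- 2))"
      by (intro summable_mult summable_ignore_initial_segment) (simp add: summable_real_powr_iff)
    then show ?thesis using C(1) by (subst suminf_ennreal2) auto
  qed
  finally have "AE \<omega> in P. (\<Sum>n. ennreal (Y (n + N) \<omega> ^ (2 * q))) \<noteq> \<infinity>"
    by (intro nn_integral_PInf_AE borel_measurable_suminf_order Y_meas) auto
  then show ?thesis
    using AE_space
  proof eventually_elim
    case (elim \<omega>)
    define S where "S = (\<Sum>n. ennreal (Y (n + N) \<omega> ^ (2 * q)))"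
    have "S \<noteq> \<infinity>" using elim by (simp add: S_def)
    then obtain B where B: "0 \<le> B" "S = ennreal B" by (cases S) auto
    \<comment> \<open>A value above \<open>1\<close> is at most its own power, which is a single
      term of the series with sum \<open>B\<close>.\<close>
    have "Y n \<omega> \<le> max 1 B" if "N \<le> n" for n
    proof (cases "Y n \<omega> \<le> 1")
      case False
      have "sum f {k} \<le> suminf f" for f :: "nat \<Rightarrow> ennreal" and k by (intro sum_le_suminf) auto
      from this[of "\<lambda>n. ennreal (Y (n + N) \<omega> ^ (2 * q))" "n - N"]
      have "ennreal (Y n \<omega> ^ (2 * q)) \<le> ennreal B" using that B by (simp add: S_def)
      then have "Y n \<omega> ^ (2 * q) \<le> B" using B by simp
      moreover have "Y n \<omega> ^ 1 \<le> Y n \<omega> ^ (2 * q)" using False q0 by (intro power_increasing) auto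
      ultimately show ?thesis by simp
    qed auto
    then show ?case
      using t elim N(1) by (intro bounded_transform_of_sqrt[where N = N and B = "max 1 B"]) (auto simp: Y_def)
  qed
qed

section \<open>From decay to the Fourier dimension\<close>

lemma le_fourier_dim:
  assumes "\<omega> \<in> space P" "0 \<le> t" "t \<le> 1"
    and "bounded (range (\<lambda>\<xi>. cmod (transform \<omega> \<xi>) * \<bar>\<xi>\<bar> powr (t / 2)))"
  shows "t \<le> fourier_dim (distr lam borel (perturb E \<omega>))"
  unfolding fourier_dim_def fourier_transform_distr_perturb[OF assms(1)]
  using assms by (intro cSup_upper) (auto intro: bdd_aboveI[of _ 1])

text \<open>Decay is available for each \<open>t < s\<close> outside a null set depending on
  \<open>t\<close>. A sequence increasing to \<open>s\<close> needs only countably many null sets,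
  and the bounds pass to the limit.\<close>

theorem AE_le_fourier_dim:
  assumes decay: "(fourier_transform \<nu> \<longlongrightarrow> 0) at_infinity"
    and s: "0 \<le> s" "s \<le> 1" and b: "0 < b" and x0: "0 < x0"
    and gaps: "\<And>J x. is_interval J \<Longrightarrow> x0 \<le> x \<Longrightarrow> 0 < measure lam (J \<inter> E) \<Longrightarrow>
           a + b * (ln (measure lam (J \<inter> E)) + s * ln x) \<le> real (gap_count E \<delta> J x)"
  shows "AE \<omega> in P. s \<le> fourier_dim (distr lam borel (perturb E \<omega>))"
\<comment> \<open>For \<open>s = 0\<close> there is no \<open>t\<close> with
  \<open>0 \<le> t < s\<close>; the trivial bound \<open>1\<close> on the transform
  suffices.\<close>
proof (cases "s = 0")
  case True
  show ?thesis
  proof (rule AE_I2)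
    fix \<omega> assume "\<omega> \<in> space P"
    moreover have "bounded (range (\<lambda>\<xi>. cmod (transform \<omega> \<xi>) * \<bar>\<xi>\<bar> powr (0 / 2)))"
      unfolding bounded_iff using norm_transform_le_one by (intro exI[of _ 1]) auto
    ultimately show "s \<le> fourier_dim (distr lam borel (perturb E \<omega>))"
      unfolding True by (intro le_fourier_dim) auto
  qed
next
  case False
  obtain \<xi>0 where \<xi>0: "0 < \<xi>0" "\<And>q. \<exists>C\<ge>0. \<forall>\<xi>\<ge>\<xi>0.
    (\<integral>\<^sup>+\<omega>. ennreal (cmod (transform \<omega> \<xi>) ^ (2 * q)) \<partial>P) \<le> ennreal (C * \<xi> powr (- s * real q))"
    using transform_moment_decay[OF decay b x0 gaps] by blast
  define t where "t k = s * (real k / real (Suc k))" for k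
  have t: "0 \<le> t k" "t k < s" for k
    using s False by (auto simp: t_def field_simps)
  have lim: "t \<longlonglongrightarrow> s"
    using tendsto_mult[OF tendsto_const[of s] LIMSEQ_n_over_Suc_n] by (simp add: t_def[abs_def])
  have "AE \<omega> in P. \<forall>k. bounded (range (\<lambda>\<xi>. cmod (transform \<omega> \<xi>) * \<bar>\<xi>\<bar> powr (t k / 2)))"
    unfolding AE_all_countable by (intro allI AE_transform_decay[OF \<xi>0] t s)
  then show ?thesis
    using AE_space
  proof eventually_elim
    case (elim \<omega>)
    have "t k \<le> fourier_dim (distr lam borel (perturb E \<omega>))" for k
      using elim t[of k] s by (intro le_fourier_dim) auto
    then show ?case by (intro LIMSEQ_le_const2[OF lim]) auto
  qed
qed

end

theorem theorem2:
  fixes E :: "real set"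
    and \<delta> :: "real set \<Rightarrow> real"
    and \<nu> lam :: "real measure"
    and s a b x0 :: real
  assumes "compact E"
    and "\<And>U. U \<in> bounded_gaps E \<Longrightarrow> 0 \<le> \<delta> U"
    and "\<delta> summable_on bounded_gaps E"
    and "prob_space \<nu>" and "sets \<nu> = sets (restrict_space borel {0..1})"
    and "(fourier_transform \<nu> \<longlongrightarrow> 0) at_infinity"
    and "0 \<le> s" and "s \<le> 1"
    and "prob_space lam" and "sets lam = sets (restrict_space borel E)"
    and "0 < b" and "0 < x0"
    and "\<And>J x. is_interval J \<Longrightarrow> x0 \<le> x \<Longrightarrow> 0 < measure lam (J \<inter> E) \<Longrightarrow>
           a + b * (ln (measure lam (J \<inter> E)) + s * ln x) \<le> real (gap_count E \<delta> J x)"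
  shows "AE \<omega> in perturbation_measure E \<delta> \<nu>. s \<le> fourier_dim (distr lam borel (perturb E \<omega>))"
proof -
  \<comment> \<open>Setting \<open>\<delta>\<close> to zero off the gaps makes it non-negative
    everywhere, as the locale demands, and changes neither the measure nor the count.\<close>
  define \<delta>' where "\<delta>' U = (if U \<in> bounded_gaps E then \<delta> U else 0)" for U
  have P: "perturbation_measure E \<delta>' \<nu> = perturbation_measure E \<delta> \<nu>"
    unfolding perturbation_measure_def by (rule PiM_cong) (auto simp: \<delta>'_def)
  have count: "gap_count E \<delta>' = gap_count E \<delta>"
    unfolding gap_count_def[abs_def] \<delta>'_def by (intro ext arg_cong[where f = card]) auto
  have "gap_perturbation E \<delta>' \<nu> lam"
  proof (rule gap_perturbation.intro)
    show "0 \<le> \<delta>' U" for U using assms(2)[of U] by (simp add: \<delta>'_def)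
    show "\<delta>' summable_on bounded_gaps E"
      using assms(3) by (rule summable_on_cong[THEN iffD1, rotated]) (simp add: \<delta>'_def)
  qed fact+
  from gap_perturbation.AE_le_fourier_dim[OF this assms(6,7,8,11,12), of a]
  show ?thesis using assms(13) unfolding P count .
qed

end
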